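(* Let $M=\prod_{t\in T}M_t$ be a product of connected (finite-dimensional) manifolds, where $T$ has cardinality at most $2^{\aleph_0}$. Then every $f\in\mathcal C^\infty(M)$ is continuous (for the product topology) and countably cylindrical, i.e. there exist an at most countable subset $T_0\subset T$ and a $\mathcal C^\infty$ function $f_{T_0}:\prod_{t\in T_0}M_t\to\mathbb R$ such that $f=f_{T_0}\circ\pi_{T_0}$, where $\pi_{T_0}:M\to\prod_{t\in T_0}M_t$ is the coordinate projection.
   Context: The canonical $\mathcal C^\infty$ structure on a product $\prod_{t\in S}M_t$ of manifolds: its structure curves are the maps $c:\mathbb R\to\prod_tM_t$ whose components $c_t:\mathbb R\to M_t$ are all smooth, and its $\mathcal C^\infty$ functions are the $f:\prod_tM_t\to\mathbb R$ with $f\circ c\in C^\infty(\mathbb R,\mathbb R)$ for every structure curve $c$. *)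

theory Defs
  imports "HOL-Analysis.Analysis" "HOL-Library.Equipollence"
begin

text \<open>R^n is modelled as the functions nat => real vanishing from index n on;
 the product topology on nat => real induces the Euclidean topology on it.\<close>

definition Rn :: "nat \<Rightarrow> (nat \<Rightarrow> real) set" where
  "Rn n = {x. \<forall>i\<ge>n. x i = 0}"

definition has_partial :: "nat \<Rightarrow> ((nat \<Rightarrow> real) \<Rightarrow> real) \<Rightarrow> (nat \<Rightarrow> real) \<Rightarrow> bool" where
  "has_partial i g x = ((\<lambda>s. g (x(i := x i + s))) differentiable (at 0))"

definition partial_deriv :: "nat \<Rightarrow> ((nat \<Rightarrow> real) \<Rightarrow> real) \<Rightarrow> (nat \<Rightarrow> real) \<Rightarrow> real" where
  "partial_deriv i g x = deriv (\<lambda>s. g (x(i := x i + s))) 0"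

fun Ck :: "nat \<Rightarrow> nat \<Rightarrow> (nat \<Rightarrow> real) set \<Rightarrow> ((nat \<Rightarrow> real) \<Rightarrow> real) \<Rightarrow> bool" where
  "Ck 0 n U g = continuous_on U g"
| "Ck (Suc k) n U g = (continuous_on U g \<and> (\<forall>i<n. \<forall>x\<in>U. has_partial i g x)
                        \<and> (\<forall>i<n. Ck k n U (partial_deriv i g)))"

definition smooth_fun :: "nat \<Rightarrow> (nat \<Rightarrow> real) set \<Rightarrow> ((nat \<Rightarrow> real) \<Rightarrow> real) \<Rightarrow> bool" where
  "smooth_fun n U g = (\<forall>k. Ck k n U g)"

definition smooth_real :: "real set \<Rightarrow> (real \<Rightarrow> real) \<Rightarrow> bool" where
  "smooth_real S f = (\<forall>k. \<forall>x\<in>S. ((deriv ^^ k) f) differentiable (at x))"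

definition chart_on :: "'a topology \<Rightarrow> nat \<Rightarrow> ('a \<Rightarrow> nat \<Rightarrow> real) \<Rightarrow> 'a set \<Rightarrow> bool" where
  "chart_on X n \<phi> U =
     (openin X U \<and> \<phi> ` U \<subseteq> Rn n \<and> openin (subtopology euclidean (Rn n)) (\<phi> ` U)
      \<and> homeomorphic_map (subtopology X U) (subtopology euclidean (\<phi> ` U)) \<phi>)"

definition smooth_manifold ::
  "'a topology \<Rightarrow> nat \<Rightarrow> (('a \<Rightarrow> nat \<Rightarrow> real) \<times> 'a set) set \<Rightarrow> bool" where
  "smooth_manifold X n A =
     (Hausdorff_space X \<and> second_countable X
      \<and> (\<forall>(\<phi>, U)\<in>A. chart_on X n \<phi> U)
      \<and> topspace X \<subseteq> (\<Union>(\<phi>, U)\<in>A. U)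
      \<and> (\<forall>(\<phi>, U)\<in>A. \<forall>(\<psi>, V)\<in>A. \<forall>j<n.
            smooth_fun n (\<phi> ` (U \<inter> V)) (\<lambda>y. \<psi> (inv_into U \<phi> y) j)))"

definition smooth_curve ::
  "'a topology \<Rightarrow> (('a \<Rightarrow> nat \<Rightarrow> real) \<times> 'a set) set \<Rightarrow> (real \<Rightarrow> 'a) \<Rightarrow> bool" where
  "smooth_curve X A c =
     (continuous_map euclideanreal X c
      \<and> (\<forall>(\<phi>, U)\<in>A. \<forall>j. smooth_real {s. c s \<in> U} (\<lambda>s. \<phi> (c s) j)))"

text \<open>Points of prod_{t in S} M_t are the extensional functions in
 topspace (product_topology M S).\<close>

definition prod_curve ::
  "('i \<Rightarrow> 'a topology) \<Rightarrow> ('i \<Rightarrow> (('a \<Rightarrow> nat \<Rightarrow> real) \<times> 'a set) set) \<Rightarrow> 'i set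
    \<Rightarrow> (real \<Rightarrow> 'i \<Rightarrow> 'a) \<Rightarrow> bool" where
  "prod_curve M A S c =
     ((\<forall>s. c s \<in> topspace (product_topology M S))
      \<and> (\<forall>t\<in>S. smooth_curve (M t) (A t) (\<lambda>s. c s t)))"

definition prod_smooth ::
  "('i \<Rightarrow> 'a topology) \<Rightarrow> ('i \<Rightarrow> (('a \<Rightarrow> nat \<Rightarrow> real) \<times> 'a set) set) \<Rightarrow> 'i set
    \<Rightarrow> (('i \<Rightarrow> 'a) \<Rightarrow> real) \<Rightarrow> bool" where
  "prod_smooth M A S f = (\<forall>c. prod_curve M A S c \<longrightarrow> smooth_real UNIV (f \<circ> c))"

end

theory Submission
  imports Defs
begin

text \<open>
  Given times \<open>a\<^sub>k\<close> decreasing to \<open>0\<close>, any sequence that converges fast enough in a chart of a connected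
  manifold lies on a smooth curve through its members at the times \<open>a\<^sub>k\<close>; how fast depends only on
  \<open>a\<close>, so in a product one can treat all coordinates at once. This gives two facts on \<open>f\<close>.

  First, \<open>f(x\<^sub>k) \<rightarrow> f(x)\<close> whenever all coordinates of \<open>x\<^sub>k\<close> converge fast enough. Second, if every
  coordinate of \<open>x\<^sub>k\<close> is eventually equal to that of \<open>x\<close>, the times are arbitrary, and choosing
  \<open>a\<^sub>k\<close> much smaller than \<open>|f(x\<^sub>k) - f(x)|\<close> contradicts differentiability at \<open>0\<close> unless
  \<open>f(x\<^sub>k) = f(x)\<close> eventually.

  By the second fact, for points \<open>x, y\<close> the value of \<open>f\<close> at the point equal to \<open>y\<close> on \<open>B\<close> and to \<open>x\<close>
  off \<open>B\<close> is a function of \<open>B \<subseteq> T\<close> that is eventually constant along pointwise convergent sequences.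
  As \<open>T\<close> embeds into the unit interval, such a function takes its value at \<open>T\<close> also at a countable set.
  Hence if no countable set of coordinates of \<open>q\<close> determined \<open>f(q)\<close>, there would be points \<open>w\<^sub>k\<close>
  differing from \<open>q\<close> on disjoint sets with \<open>f(w\<^sub>k) \<noteq> f(q)\<close>, against the second fact. Closing off
  under these countable sets over a countable family of points with dense projections gives \<open>T\<^sub>0\<close>,
  and the first fact shows that \<open>T\<^sub>0\<close> determines \<open>f\<close> and that \<open>f\<close> is continuous.
\<close>

section \<open>Smooth functions of a real variable\<close>

text \<open>Asking for some derivative at each order, instead of iterating \<open>deriv\<close>,
  lets the sum, product and chain rules be proved by induction on the order with explicit
  derivatives.\<close>

primrec times_differentiable_on :: "nat \<Rightarrow> real set \<Rightarrow> (real \<Rightarrow> real) \<Rightarrow> bool" where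
  "times_differentiable_on 0 S f = True"
| "times_differentiable_on (Suc k) S f =
     (\<exists>f'. (\<forall>x\<in>S. (f has_real_derivative f' x) (at x)) \<and> times_differentiable_on k S f')"

lemma times_differentiable_onI:
  assumes "\<And>x. x \<in> S \<Longrightarrow> (f has_real_derivative f' x) (at x)" "times_differentiable_on k S f'"
  shows "times_differentiable_on (Suc k) S f"
  using assms by auto

lemma times_differentiable_on_Suc_D:
  "times_differentiable_on (Suc k) S f \<Longrightarrow> times_differentiable_on k S f"
  by (induction k arbitrary: f) auto

lemma times_differentiable_on_cong:
  assumes "open S" "\<And>x. x \<in> S \<Longrightarrow> f x = g x" "times_differentiable_on k S f"
  shows "times_differentiable_on k S g"
proof (cases k)
  case (Suc m)
  then obtain f' where "\<forall>x\<in>S. (f has_real_derivative f' x) (at x)" "times_differentiable_on m S f'"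
    using assms by auto
  then show ?thesis
    unfolding Suc times_differentiable_on.simps
    using has_field_derivative_transform_within_open[of f _ _ S g] assms(1,2) by blast
qed auto

lemma deriv_eq_on_open:
  assumes "open S" "\<And>x. x \<in> S \<Longrightarrow> f x = g x" "x \<in> S"
  shows "(deriv ^^ k) f x = (deriv ^^ k) g x"
  using assms(3)
proof (induction k arbitrary: x)
  case (Suc k)
  have "eventually (\<lambda>y. (deriv ^^ k) f y = (deriv ^^ k) g y) (nhds x)"
    using Suc assms(1) eventually_nhds by blast
  then show ?case by (simp add: deriv_cong_ev)
qed (use assms in auto)

text \<open>Iterated derivatives at a point depend only on the germ there. This serves curves that
  coincide near each time with one already known to be smooth.\<close>

lemma smooth_real_local:
  assumes "\<And>x. x \<in> S \<Longrightarrow> \<exists>N g. open N \<and> x \<in> N \<and> (\<forall>y\<in>N. f y = g y) \<and> smooth_real N g"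
  shows "smooth_real S f"
  unfolding smooth_real_def
proof (intro allI ballI)
  fix k x assume "x \<in> S"
  then obtain N g where N: "open N" "x \<in> N" "\<forall>y\<in>N. f y = g y" "smooth_real N g"
    using assms by blast
  have "(deriv ^^ k) f y = (deriv ^^ k) g y" if "y \<in> N" for y
    using deriv_eq_on_open[OF N(1)] N(3) that by blast
  moreover have "(deriv ^^ k) g differentiable (at x)"
    using N by (auto simp: smooth_real_def)
  ultimately show "(deriv ^^ k) f differentiable (at x)"
    using N(1,2) has_field_derivative_transform_within_open[of "(deriv ^^ k) g" _ x N "(deriv ^^ k) f"]
    unfolding real_differentiable_def by metis
qed

lemma smooth_real_deriv: "smooth_real S f \<Longrightarrow> smooth_real S (deriv f)"
  unfolding smooth_real_def by (metis funpow_Suc_right o_apply)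

lemma smooth_real_imp_times_differentiable_on:
  "smooth_real S f \<Longrightarrow> times_differentiable_on k S f"
proof (induction k arbitrary: f)
  case (Suc k)
  have "(f has_real_derivative deriv f x) (at x)" if "x \<in> S" for x
    using Suc.prems that DERIV_deriv_iff_real_differentiable
    unfolding smooth_real_def by (metis funpow_0)
  moreover have "times_differentiable_on k S (deriv f)"
    using Suc smooth_real_deriv by blast
  ultimately show ?case by auto
qed auto

text \<open>On an open set every witness for the first derivative agrees with
  \<open>deriv f\<close>, so by congruence it can be replaced by \<open>deriv f\<close>
  itself.\<close>

lemma times_differentiable_on_imp_deriv_differentiable:
  assumes "open S" "x \<in> S"
  shows "times_differentiable_on (Suc k) S f \<Longrightarrow> (deriv ^^ k) f differentiable (at x)"
proof (induction k arbitrary: f)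
  case 0
  then show ?case using assms by (auto simp: real_differentiable_def)
next
  case (Suc k)
  obtain f' where f': "\<forall>x\<in>S. (f has_real_derivative f' x) (at x)" "times_differentiable_on (Suc k) S f'"
    using Suc.prems by auto
  have "times_differentiable_on (Suc k) S (deriv f)"
    using times_differentiable_on_cong[OF assms(1) _ f'(2)] f'(1) DERIV_imp_deriv by metis
  then have "(deriv ^^ k) (deriv f) differentiable (at x)" by (rule Suc.IH)
  then show ?case by (simp only: funpow_Suc_right o_def)
qed

lemma smooth_real_iff:
  "open S \<Longrightarrow> smooth_real S f \<longleftrightarrow> (\<forall>k. times_differentiable_on k S f)"
  using smooth_real_imp_times_differentiable_on times_differentiable_on_imp_deriv_differentiable
  unfolding smooth_real_def by blast

lemma times_differentiable_on_const: "times_differentiable_on k S (\<lambda>x. c)"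
  by (induction k arbitrary: c) (auto intro!: exI[of _ "\<lambda>_. 0"])

lemma times_differentiable_on_ident: "times_differentiable_on k S (\<lambda>x. x)"
  by (cases k) (auto intro!: exI[of _ "\<lambda>_. 1"] times_differentiable_on_const)

lemma times_differentiable_on_add:
  "times_differentiable_on k S f \<Longrightarrow> times_differentiable_on k S g
    \<Longrightarrow> times_differentiable_on k S (\<lambda>x. f x + g x)"
proof (induction k arbitrary: f g)
  case (Suc k)
  then obtain f' g' where
    "\<forall>x\<in>S. (f has_real_derivative f' x) (at x)" "times_differentiable_on k S f'"
    "\<forall>x\<in>S. (g has_real_derivative g' x) (at x)" "times_differentiable_on k S g'" by auto
  then show ?case
    by (intro times_differentiable_onI[where f'="\<lambda>x. f' x + g' x"] Suc.IH)
       (auto intro!: derivative_eq_intros)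
qed auto

lemma times_differentiable_on_mult:
  "times_differentiable_on k S f \<Longrightarrow> times_differentiable_on k S g
    \<Longrightarrow> times_differentiable_on k S (\<lambda>x. f x * g x)"
proof (induction k arbitrary: f g)
  case (Suc k)
  then obtain f' g' where
    "\<forall>x\<in>S. (f has_real_derivative f' x) (at x)" "times_differentiable_on k S f'"
    "\<forall>x\<in>S. (g has_real_derivative g' x) (at x)" "times_differentiable_on k S g'" by auto
  moreover have "times_differentiable_on k S f" "times_differentiable_on k S g"
    using Suc.prems times_differentiable_on_Suc_D by auto
  ultimately show ?case
    by (intro times_differentiable_onI[where f'="\<lambda>x. f' x * g x + g' x * f x"]
        times_differentiable_on_add Suc.IH)
       (auto intro!: derivative_eq_intros)
qed auto

lemma times_differentiable_on_sum:
  assumes "\<And>i. i \<in> I \<Longrightarrow> times_differentiable_on k S (f i)"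
  shows "times_differentiable_on k S (\<lambda>x. \<Sum>i\<in>I. f i x)"
  using assms
  by (induction I rule: infinite_finite_induct)
     (auto simp: times_differentiable_on_const intro!: times_differentiable_on_add)

lemma times_differentiable_on_inverse:
  assumes "\<And>x. x \<in> S \<Longrightarrow> f x \<noteq> 0"
  shows "times_differentiable_on k S f \<Longrightarrow> times_differentiable_on k S (\<lambda>x. inverse (f x))"
proof (induction k)
  case (Suc k)
  then obtain f' where f':
    "\<forall>x\<in>S. (f has_real_derivative f' x) (at x)" "times_differentiable_on k S f'" by auto
  have "times_differentiable_on k S (\<lambda>x. inverse (f x))"
    using Suc times_differentiable_on_Suc_D by auto
  with f' show ?case
    by (intro times_differentiable_onI[where f'="\<lambda>x. (-1) * (f' x * (inverse (f x) * inverse (f x)))"]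
        times_differentiable_on_mult times_differentiable_on_const)
       (auto intro!: derivative_eq_intros simp: assms)
qed auto

lemma times_differentiable_on_compose:
  assumes "\<And>x. x \<in> S \<Longrightarrow> g x \<in> R"
  shows "times_differentiable_on k R f \<Longrightarrow> times_differentiable_on k S g
    \<Longrightarrow> times_differentiable_on k S (\<lambda>x. f (g x))"
proof (induction k arbitrary: f)
  case (Suc k)
  then obtain f' g' where *:
    "\<forall>x\<in>R. (f has_real_derivative f' x) (at x)" "times_differentiable_on k R f'"
    "\<forall>x\<in>S. (g has_real_derivative g' x) (at x)" "times_differentiable_on k S g'" by auto
  show ?case
  proof (rule times_differentiable_onI[where f'="\<lambda>x. f' (g x) * g' x"])
    show "((\<lambda>x. f (g x)) has_real_derivative f' (g x) * g' x) (at x)" if "x \<in> S" for x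
      using DERIV_chain2 * that assms by blast
    show "times_differentiable_on k S (\<lambda>x. f' (g x) * g' x)"
      by (rule times_differentiable_on_mult
          [OF Suc.IH[OF *(2) times_differentiable_on_Suc_D[OF Suc.prems(2)]] *(4)])
  qed
qed auto

lemmas times_differentiable_on_intros =
  times_differentiable_on_const times_differentiable_on_ident times_differentiable_on_add
  times_differentiable_on_mult times_differentiable_on_inverse

lemma smooth_real_const: "smooth_real S (\<lambda>x. c)"
proof -
  have "smooth_real UNIV (\<lambda>x. c)"
    by (simp add: smooth_real_iff times_differentiable_on_const)
  then show ?thesis by (simp add: smooth_real_def)
qed

text \<open>The functions \<open>p(1/x) exp(-1/x)\<close>, extended by zero, are closed under differentiation.\<close>

definition flat_fun :: "real poly \<Rightarrow> real \<Rightarrow> real" where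
  "flat_fun p x = (if x \<le> 0 then 0 else poly p (inverse x) * exp (- inverse x))"

lemma poly_mult_exp_minus_tendsto_0:
  "((\<lambda>x::real. poly p x * exp (- x)) \<longlongrightarrow> 0) at_top"
proof -
  have "((\<lambda>x::real. \<Sum>i\<le>degree p. coeff p i * (x ^ i / exp x)) \<longlongrightarrow> (\<Sum>i\<le>degree p. coeff p i * 0)) at_top"
    by (intro tendsto_sum tendsto_mult tendsto_const tendsto_power_div_exp_0)
  moreover have "poly p x * exp (- x) = (\<Sum>i\<le>degree p. coeff p i * (x ^ i / exp x))" for x :: real
    by (simp add: poly_altdef sum_distrib_right exp_minus field_simps sum_divide_distrib)
  ultimately show ?thesis by simp
qed

text \<open>With \<open>u = 1/x\<close> the derivative of \<open>p(u) exp(-u)\<close> is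
  \<open>u^2 (p(u) - p'(u)) exp(-u)\<close>, whence the polynomial in the statement. At
  \<open>0\<close> the difference quotient from the right is again a polynomial in \<open>u\<close>
  times \<open>exp(-u)\<close>.\<close>

lemma has_derivative_flat_fun:
  "(flat_fun p has_real_derivative flat_fun (monom 1 2 * (p - pderiv p)) x) (at x)"
proof -
  let ?q = "monom 1 2 * (p - pderiv p)"
  consider "x < 0" | "x = 0" | "x > 0" by linarith
  then show ?thesis
  proof cases
    case 1
    have "(flat_fun p has_real_derivative 0) (at x)"
      by (rule has_field_derivative_transform_within_open[where S="{..<0}" and f="\<lambda>_. 0"])
         (use 1 in \<open>auto simp: flat_fun_def\<close>)
    then show ?thesis using 1 by (simp add: flat_fun_def)
  next
    case 2
    have "((\<lambda>h. flat_fun p h / h) \<longlongrightarrow> 0) (at_left 0)"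
      by (rule tendsto_eventually)
         (auto simp: flat_fun_def eventually_at_filter)
    moreover have "((\<lambda>h. flat_fun p h / h) \<longlongrightarrow> 0) (at_right 0)"
    proof (rule Lim_transform_eventually)
      show "((\<lambda>h. poly (pCons 0 p) (inverse h) * exp (- inverse h)) \<longlongrightarrow> 0) (at_right (0::real))"
        by (rule filterlim_compose[OF poly_mult_exp_minus_tendsto_0 filterlim_inverse_at_top_right])
      show "\<forall>\<^sub>F h in at_right 0. poly (pCons 0 p) (inverse h) * exp (- inverse h) = flat_fun p h / h"
        by (auto simp: flat_fun_def eventually_at_filter field_simps)
    qed
    ultimately have "((\<lambda>h. flat_fun p h / h) \<longlongrightarrow> 0) (at 0)"
      using filterlim_split_at by blast
    then show ?thesis using 2 by (simp add: DERIV_def flat_fun_def)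
  next
    case 3
    have "((\<lambda>x. poly p (inverse x) * exp (- inverse x)) has_real_derivative
            poly ?q (inverse x) * exp (- inverse x)) (at x)"
      using 3
      by (auto intro!: derivative_eq_intros DERIV_chain2[OF poly_DERIV]
               simp: poly_monom field_simps power2_eq_square)
    then have "(flat_fun p has_real_derivative poly ?q (inverse x) * exp (- inverse x)) (at x)"
      by (rule has_field_derivative_transform_within_open[where S="{0<..}"])
         (use 3 in \<open>auto simp: flat_fun_def\<close>)
    then show ?thesis using 3 by (simp add: flat_fun_def)
  qed
qed

lemma times_differentiable_on_flat_fun: "times_differentiable_on k S (flat_fun p)"
  by (induction k arbitrary: p) (auto intro!: exI has_derivative_flat_fun)

section \<open>Smooth transition functions\<close>

text \<open>\<open>flat_fun 1\<close> is \<open>exp(-1/x)\<close> extended by zero, and the quotient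
  is the usual smooth transition from 0 to 1 on the unit interval.\<close>

definition smooth_step :: "real \<Rightarrow> real" where
  "smooth_step x = flat_fun 1 x * inverse (flat_fun 1 x + flat_fun 1 (1 - x))"

lemma smooth_step_denominator_pos: "flat_fun 1 x + flat_fun 1 (1 - x) > 0"
  by (simp add: flat_fun_def add_pos_pos)

lemma times_differentiable_on_smooth_step: "times_differentiable_on k S smooth_step"
proof -
  have "times_differentiable_on k S (\<lambda>x. 1 + (-1) * x)"
    by (intro times_differentiable_on_intros)
  then have "times_differentiable_on k S (\<lambda>x. 1 - x)" by simp
  then have "times_differentiable_on k S (\<lambda>x. flat_fun 1 (1 - x))"
    by (rule times_differentiable_on_compose[OF UNIV_I times_differentiable_on_flat_fun])
  then have "times_differentiable_on k S (\<lambda>x. flat_fun 1 x + flat_fun 1 (1 - x))"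
    by (rule times_differentiable_on_add[OF times_differentiable_on_flat_fun])
  moreover have "flat_fun 1 x + flat_fun 1 (1 - x) \<noteq> 0" for x
    using smooth_step_denominator_pos[of x] by simp
  ultimately have "times_differentiable_on k S (\<lambda>x. inverse (flat_fun 1 x + flat_fun 1 (1 - x)))"
    by (intro times_differentiable_on_inverse)
  then have "times_differentiable_on k S (\<lambda>x. flat_fun 1 x * inverse (flat_fun 1 x + flat_fun 1 (1 - x)))"
    by (rule times_differentiable_on_mult[OF times_differentiable_on_flat_fun])
  then show ?thesis unfolding smooth_step_def[abs_def] .
qed

lemma smooth_step_eq_0: "x \<le> 0 \<Longrightarrow> smooth_step x = 0"
  by (simp add: smooth_step_def flat_fun_def)

lemma smooth_step_eq_1: "x \<ge> 1 \<Longrightarrow> smooth_step x = 1"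
  by (simp add: smooth_step_def flat_fun_def)

lemma smooth_step_bounds: "0 \<le> smooth_step x" "smooth_step x \<le> 1"
proof -
  have "flat_fun 1 y \<ge> 0" for y by (simp add: flat_fun_def)
  then have "0 \<le> flat_fun 1 x / (flat_fun 1 x + flat_fun 1 (1 - x))"
    "flat_fun 1 x / (flat_fun 1 x + flat_fun 1 (1 - x)) \<le> 1"
    using smooth_step_denominator_pos[of x] by (simp_all add: divide_le_eq_1)
  then show "0 \<le> smooth_step x" "smooth_step x \<le> 1"
    by (simp_all add: smooth_step_def divide_inverse)
qed

section \<open>Termwise differentiation of series\<close>

lemma smooth_real_has_deriv:
  "smooth_real S h \<Longrightarrow> s \<in> S \<Longrightarrow>
    ((deriv ^^ m) h has_real_derivative (deriv ^^ Suc m) h s) (at s)"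
  unfolding smooth_real_def by (simp add: DERIV_deriv_iff_real_differentiable)

text \<open>The M-test is applied to each order of derivative separately. The bound at order
  \<open>m\<close> holds from the index \<open>m\<close> on, which suffices because finitely many
  terms do not affect uniform convergence.\<close>

lemma smooth_real_suminf:
  fixes u :: "nat \<Rightarrow> real \<Rightarrow> real"
  assumes sm: "\<And>k. smooth_real UNIV (u k)"
    and bd: "\<And>m k s. m \<le> k \<Longrightarrow> \<bar>(deriv ^^ m) (u k) s\<bar> \<le> (1/2) ^ k"
  shows "smooth_real UNIV (\<lambda>s. \<Sum>k. u k s)"
proof -
  have unif: "uniform_limit UNIV (\<lambda>n s. \<Sum>i<n. (deriv ^^ m) (u i) s)
      (\<lambda>s. \<Sum>i. (deriv ^^ m) (u i) s) sequentially" for m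
    by (rule Weierstrass_m_test_ev[where M="\<lambda>k. (1/2) ^ k"])
       (auto simp: bd eventually_sequentially summable_geometric intro!: exI[of _ m])
  have summ: "summable (\<lambda>k. (deriv ^^ m) (u k) s)" for m s
    by (rule summable_comparison_test[where g="\<lambda>k. (1/2) ^ k"])
       (auto simp: bd summable_geometric intro!: exI[of _ m])
  have step: "((\<lambda>s. \<Sum>k. (deriv ^^ m) (u k) s) has_real_derivative
      (\<Sum>k. (deriv ^^ Suc m) (u k) s)) (at s)" for m s
  proof (rule has_field_derivative_series'(2)[of UNIV "\<lambda>k. (deriv ^^ m) (u k)"
        "\<lambda>k. (deriv ^^ Suc m) (u k)" 0 s])
    show "uniformly_convergent_on UNIV (\<lambda>n s. \<Sum>i<n. (deriv ^^ Suc m) (u i) s)"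
      using unif[of "Suc m"] unfolding uniformly_convergent_on_def by blast
    show "((deriv ^^ m) (u k) has_real_derivative (deriv ^^ Suc m) (u k) x) (at x within UNIV)" for k x
      by (rule smooth_real_has_deriv[OF sm UNIV_I])
  qed (use summ in auto)
  \<comment> \<open>All \<open>m\<close> are treated at once, because differentiating the series of
    order \<open>m\<close> leads to that of order \<open>Suc m\<close>.\<close>
  have "times_differentiable_on j UNIV (\<lambda>s. \<Sum>k. (deriv ^^ m) (u k) s)" for j m
  proof (induction j arbitrary: m)
    case (Suc j)
    then show ?case using step by (auto simp del: funpow.simps intro!: exI)
  qed auto
  from this[where m=0] show ?thesis by (simp add: smooth_real_iff)
qed

lemma deriv_const_eq: "(deriv ^^ m) (\<lambda>_. c :: real) = (if m = 0 then (\<lambda>_. c) else (\<lambda>_. 0))"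
  by (induction m) auto

lemma deriv_cmult_eq:
  assumes "smooth_real UNIV h"
  shows "(deriv ^^ m) (\<lambda>s. v * h s) = (\<lambda>s. v * (deriv ^^ m) h s)"
proof (induction m)
  case (Suc m)
  have "deriv (\<lambda>s. v * (deriv ^^ m) h s) = (\<lambda>s. v * (deriv ^^ Suc m) h s)"
    using DERIV_cmult[OF smooth_real_has_deriv[OF assms UNIV_I]] DERIV_imp_deriv by blast
  then show ?case by (simp add: Suc)
qed auto

text \<open>Outside \<open>[a, b]\<close> the derivatives are those of constants, and on the compact
  interval they are continuous. The bound is at least 1 so that sums of such bounds can be divided
  by.\<close>

lemma deriv_bounded_if_constant_near_infinity:
  assumes sm: "smooth_real UNIV h" and "\<And>s. s < a \<Longrightarrow> h s = c" "\<And>s. s > b \<Longrightarrow> h s = d"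
  shows "\<exists>B\<ge>1. \<forall>s. \<bar>(deriv ^^ m) h s\<bar> \<le> B"
proof -
  have "continuous_on {a..b} ((deriv ^^ m) h)"
    by (intro continuous_at_imp_continuous_on ballI DERIV_isCont[OF smooth_real_has_deriv[OF sm UNIV_I]])
  then have "bounded ((deriv ^^ m) h ` {a..b})"
    by (intro compact_imp_bounded compact_continuous_image) auto
  then obtain C where C: "\<And>s. s \<in> {a..b} \<Longrightarrow> \<bar>(deriv ^^ m) h s\<bar> \<le> C"
    unfolding bounded_iff real_norm_def by blast
  have l: "\<bar>(deriv ^^ m) h s\<bar> \<le> \<bar>c\<bar>" if "s < a" for s
    using deriv_eq_on_open[of "{..<a}" h "\<lambda>_. c" s m] that assms(2)
    by (auto simp: deriv_const_eq)
  have r: "\<bar>(deriv ^^ m) h s\<bar> \<le> \<bar>d\<bar>" if "s > b" for s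
    using deriv_eq_on_open[of "{b<..}" h "\<lambda>_. d" s m] that assms(3)
    by (auto simp: deriv_const_eq)
  have "\<bar>(deriv ^^ m) h s\<bar> \<le> max 1 (max C (max \<bar>c\<bar> \<bar>d\<bar>))" for s
  proof -
    consider "s < a" | "s > b" | "s \<in> {a..b}" by force
    then show ?thesis by cases (auto simp: le_max_iff_disj l r C)
  qed
  then show ?thesis by (intro exI[of _ "max 1 (max C (max \<bar>c\<bar> \<bar>d\<bar>))"]) auto
qed

definition step_between :: "real \<Rightarrow> real \<Rightarrow> real \<Rightarrow> real" where
  "step_between a b s = smooth_step ((s - a) / (b - a))"

lemma step_between_bounds: "0 \<le> step_between a b s" "step_between a b s \<le> 1"
  by (simp_all add: step_between_def smooth_step_bounds)

lemma step_between_eq_0: "a < b \<Longrightarrow> s \<le> a \<Longrightarrow> step_between a b s = 0"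
  by (simp add: step_between_def smooth_step_eq_0 divide_nonpos_pos)

lemma step_between_eq_1: "a < b \<Longrightarrow> s \<ge> b \<Longrightarrow> step_between a b s = 1"
  by (simp add: step_between_def smooth_step_eq_1)

lemma times_differentiable_on_step_between: "times_differentiable_on k S (step_between a b)"
proof -
  have "times_differentiable_on k S (\<lambda>s. (- a) * inverse (b - a) + inverse (b - a) * s)"
    by (intro times_differentiable_on_add times_differentiable_on_mult
        times_differentiable_on_const times_differentiable_on_ident)
  moreover have "(\<lambda>s. (- a) * inverse (b - a) + inverse (b - a) * s) = (\<lambda>s. (s - a) / (b - a))"
    by (auto simp: divide_inverse algebra_simps)
  ultimately have *: "times_differentiable_on k S (\<lambda>s. (s - a) / (b - a))" by simp
  have "times_differentiable_on k S (\<lambda>s. smooth_step ((s - a) / (b - a)))"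
    by (rule times_differentiable_on_compose[OF UNIV_I times_differentiable_on_smooth_step *])
  then show ?thesis by (simp add: step_between_def[abs_def])
qed

lemma smooth_real_step_between: "smooth_real UNIV (step_between a b)"
  by (simp add: smooth_real_iff times_differentiable_on_step_between)

section \<open>Interpolation of rapidly convergent real sequences\<close>

text \<open>\<open>\<delta>\<close> depends on the times and not on the sequence, so one rate serves
  all coordinates of all factors. The constant piece after \<open>a N\<close> allows gluing, and the
  last bound keeps the curve inside a chart once \<open>N\<close> is large.\<close>

definition interpolation_rate :: "(nat \<Rightarrow> real) \<Rightarrow> (nat \<Rightarrow> real) \<Rightarrow> bool" where
  "interpolation_rate a \<delta> \<longleftrightarrow> (\<forall>k. \<delta> k > 0) \<and>
    (\<forall>y L N. (\<forall>k\<ge>N. \<bar>y k - L\<bar> < \<delta> k) \<longrightarrow>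
      (\<exists>\<gamma>. smooth_real UNIV \<gamma> \<and> (\<forall>s\<le>0. \<gamma> s = L) \<and> (\<forall>k\<ge>N. \<gamma> (a k) = y k)
         \<and> (\<forall>s\<ge>a N. \<gamma> s = y N) \<and> (\<forall>s. \<bar>\<gamma> s - L\<bar> \<le> 2 * (1/2) ^ N)))"

lemma interpolation_rateD:
  assumes "interpolation_rate a \<delta>" "\<forall>k\<ge>N. \<bar>y k - L\<bar> < \<delta> k"
  shows "\<exists>\<gamma>. smooth_real UNIV \<gamma> \<and> (\<forall>s\<le>0. \<gamma> s = L) \<and> (\<forall>k\<ge>N. \<gamma> (a k) = y k)
    \<and> (\<forall>s\<ge>a N. \<gamma> s = y N) \<and> (\<forall>s. \<bar>\<gamma> s - L\<bar> \<le> 2 * (1/2) ^ N)"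
  using assms unfolding interpolation_rate_def by simp

text \<open>The curve is \<open>L\<close> plus the sum of \<open>(y k - y (Suc k)) * h k\<close>,
  where \<open>h k\<close> rises from 0 to 1 between \<open>a (Suc k)\<close> and
  \<open>a k\<close>. At the time \<open>a M\<close> exactly the steps with \<open>k \<ge> M\<close>
  are complete, and the sum telescopes to \<open>y M - L\<close>. The rate makes the increments
  small compared with the derivatives of \<open>h k\<close> of order at most \<open>k\<close>, so
  that the series is smooth.\<close>

lemma interpolation_rate_exists:
  fixes a :: "nat \<Rightarrow> real"
  assumes dec: "\<And>k. a (Suc k) < a k" and pos: "\<And>k. 0 < a k"
  shows "\<exists>\<delta>. interpolation_rate a \<delta>"
proof -
  define h where "h k = step_between (a (Suc k)) (a k)" for k
  have h_smooth: "smooth_real UNIV (h k)" for k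
    by (simp add: h_def smooth_real_step_between)
  have h0: "h k s = 0" if "s \<le> a (Suc k)" for k s
    using that dec by (simp add: h_def step_between_eq_0)
  have h1: "h k s = 1" if "s \<ge> a k" for k s
    using that dec by (simp add: h_def step_between_eq_1)
  have a_anti: "a k \<le> a j" if "j \<le> k" for j k
    using that dec by (meson lift_Suc_antimono_le less_imp_le)
  have "\<exists>B\<ge>1. \<forall>s. \<bar>(deriv ^^ m) (h k) s\<bar> \<le> B" for m k
    by (rule deriv_bounded_if_constant_near_infinity[OF h_smooth,
          where a="a (Suc k)" and b="a k" and c=0 and d=1]) (auto simp: h0 h1)
  then obtain B where B: "\<And>m k. B m k \<ge> 1" "\<And>m k s. \<bar>(deriv ^^ m) (h k) s\<bar> \<le> B m k"
    by metis
  define C where "C k = (\<Sum>m\<le>k. B m k)" for k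
  have BC: "B m k \<le> C k" if "m \<le> k" for m k
    unfolding C_def using that B(1) by (intro member_le_sum) (auto intro: order_trans[OF zero_le_one])
  have C1: "C k \<ge> 1" for k using B(1)[of 0 k] BC[of 0 k] by simp
  define d where "d k = (1/2) ^ k / C k" for k
  have d_pos: "d k > 0" for k unfolding d_def using C1[of k] by (intro divide_pos_pos) auto
  have d_le: "d k \<le> (1/2) ^ k" for k
    unfolding d_def using C1[of k] by (simp add: divide_le_eq mult_left_le)
  \<comment> \<open>\<open>y k\<close> enters the increments with indices \<open>k\<close> and
    \<open>k - 1\<close>, hence the minimum; the half lets two deviations from \<open>L\<close> add
    up to at most \<open>d k\<close>. At \<open>k = 0\<close> the subtraction gives
    \<open>0\<close>, and the minimum is \<open>d 0\<close>.\<close>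
  define \<delta> where "\<delta> k = min (d k) (d (k - 1)) / 2" for k
  have \<delta>_pos: "\<delta> k > 0" for k by (simp add: \<delta>_def d_pos)
  have \<delta>_le: "\<delta> k \<le> d k / 2" "\<delta> (Suc k) \<le> d k / 2" for k by (auto simp: \<delta>_def)
  have "\<exists>\<gamma>. smooth_real UNIV \<gamma> \<and> (\<forall>s\<le>0. \<gamma> s = L) \<and> (\<forall>k\<ge>N. \<gamma> (a k) = y k)
       \<and> (\<forall>s\<ge>a N. \<gamma> s = y N) \<and> (\<forall>s. \<bar>\<gamma> s - L\<bar> \<le> 2 * (1/2) ^ N)"
    if y: "\<forall>k\<ge>N. \<bar>y k - L\<bar> < \<delta> k" for y L N
  proof -
    \<comment> \<open>Nothing is known of \<open>y\<close> before \<open>N\<close>, so the sequence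
      is frozen there and the increments with \<open>k < N\<close> vanish.\<close>
    define v where "v k = y (max N k) - y (max N (Suc k))" for k
    have v0: "v k = 0" if "k < N" for k using that by (simp add: v_def)
    have v: "\<bar>v k\<bar> \<le> d k" for k
    proof (cases "k < N")
      case False
      then have "\<bar>y k - L\<bar> < \<delta> k" "\<bar>y (Suc k) - L\<bar> < \<delta> (Suc k)" using y by auto
      then have "\<bar>y k - y (Suc k)\<bar> \<le> d k" using \<delta>_le[of k] by linarith
      then show ?thesis using False by (simp add: v_def max_def)
    qed (use v0 d_pos less_imp_le in auto)
    have bd: "\<bar>(deriv ^^ m) (\<lambda>s. v k * h k s) s\<bar> \<le> (1/2) ^ k" if "m \<le> k" for m k s
    proof -
      have "\<bar>v k * (deriv ^^ m) (h k) s\<bar> \<le> d k * C k"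
        unfolding abs_mult using v d_pos B(2)[of m k s] BC[OF that]
        by (intro mult_mono) (auto intro: less_imp_le order_trans)
      also have "\<dots> = (1/2) ^ k" using C1[of k] by (simp add: d_def)
      finally show ?thesis by (simp add: deriv_cmult_eq[OF h_smooth])
    qed
    have smu: "smooth_real UNIV (\<lambda>s. v k * h k s)" for k
      by (simp add: smooth_real_iff h_def times_differentiable_on_mult
          times_differentiable_on_const times_differentiable_on_step_between)
    define \<gamma> where "\<gamma> s = L + (\<Sum>k. v k * h k s)" for s
    have "smooth_real UNIV (\<lambda>s. \<Sum>k. v k * h k s)"
      by (rule smooth_real_suminf[OF smu bd])
    then have sm: "smooth_real UNIV \<gamma>"
      by (simp add: smooth_real_iff \<gamma>_def[abs_def] times_differentiable_on_add
          times_differentiable_on_const)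
    have "y \<longlonglongrightarrow> L"
    proof (rule LIM_zero_cancel, rule tendsto_rabs_zero_cancel,
        rule tendsto_sandwich[where f="\<lambda>_. 0" and h="\<lambda>k. (1/2) ^ k"])
      have "\<bar>y k - L\<bar> \<le> (1/2) ^ k" if "k \<ge> N" for k
        using y that \<delta>_le(1)[of k] d_le[of k] d_pos[of k] by fastforce
      then show "\<forall>\<^sub>F k in sequentially. \<bar>y k - L\<bar> \<le> (1/2) ^ k"
        by (auto simp: eventually_sequentially)
    qed (auto intro!: LIMSEQ_realpow_zero)
    then have lim: "(\<lambda>k. y (max M k)) \<longlonglongrightarrow> L" for M
      by (rule Lim_transform_eventually) (auto simp: eventually_sequentially intro!: exI[of _ M])
    \<comment> \<open>Terms equal to the increments of \<open>y\<close> frozen before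
      \<open>M\<close> sum to \<open>y M - L\<close>.\<close>
    have val: "\<gamma> s = y M" if M: "M \<ge> N" and "\<And>k. v k * h k s = y (max M k) - y (max M (Suc k))" for M s
      using telescope_sums'[OF lim[of M]] that by (simp add: \<gamma>_def sums_unique[symmetric])
    have "\<gamma> s = L" if "s \<le> 0" for s
    proof -
      have "h k s = 0" for k using that pos[of "Suc k"] by (intro h0) linarith
      then show ?thesis by (simp add: \<gamma>_def)
    qed
    moreover have "\<gamma> (a M) = y M" if "M \<ge> N" for M
    proof (rule val[OF that])
      fix k show "v k * h k (a M) = y (max M k) - y (max M (Suc k))"
      proof (cases "k < M")
        case True
        then have "h k (a M) = 0" by (intro h0 a_anti) auto
        then show ?thesis using True by (simp add: max_absorb1)
      next
        case False
        then have "h k (a M) = 1" by (intro h1 a_anti) auto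
        then show ?thesis using False that by (simp add: v_def max_def)
      qed
    qed
    moreover have "\<gamma> s = y N" if "s \<ge> a N" for s
    proof (rule val)
      fix k show "v k * h k s = y (max N k) - y (max N (Suc k))"
      proof (cases "k < N")
        case False
        then have "a k \<le> a N" by (intro a_anti) auto
        then have "h k s = 1" using that by (intro h1) linarith
        then show ?thesis by (simp add: v_def)
      qed (auto simp: v0)
    qed auto
    moreover have "\<bar>\<gamma> s - L\<bar> \<le> 2 * (1/2) ^ N" for s
    proof -
      \<comment> \<open>Only terms from \<open>N\<close> on can be nonzero, and the case
        \<open>m = 0\<close> of \<open>bd\<close> bounds them by a geometric tail with sum
        \<open>2 * (1/2) ^ N\<close>.\<close>
      have le: "\<bar>v (k + N) * h (k + N) s\<bar> \<le> (1/2) ^ N * (1/2) ^ k" for k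
        using bd[of 0 "k + N" s] by (simp add: power_add mult.commute)
      have geo: "(\<lambda>k. (1/2) ^ N * (1/2) ^ k) sums ((1/2) ^ N * 2 :: real)"
        using geometric_sums[of "1/2::real"] by (intro sums_mult) auto
      have summ: "summable (\<lambda>k. v (k + N) * h (k + N) s)"
        by (rule summable_comparison_test[OF _ sums_summable[OF geo]]) (use le in auto)
      have "(\<Sum>k. v k * h k s) = (\<Sum>k. v (k + N) * h (k + N) s)"
        using suminf_split_initial_segment[of "\<lambda>k. v k * h k s" N] summ v0
        by (simp add: summable_iff_shift[of "\<lambda>k. v k * h k s" N])
      moreover have "norm (\<Sum>k. v (k + N) * h (k + N) s) \<le> (\<Sum>k. (1/2) ^ N * (1/2) ^ k)"
        by (rule norm_suminf_le[OF _ sums_summable[OF geo]]) (use le in auto)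
      ultimately show ?thesis using sums_unique[OF geo] by (simp add: \<gamma>_def)
    qed
    ultimately show ?thesis using sm by blast
  qed
  then show ?thesis using \<delta>_pos unfolding interpolation_rate_def by blast
qed

section \<open>Smooth curves in manifolds\<close>

text \<open>Coordinates from \<open>n\<close> on vanish for all points of \<open>Rn n\<close>, so a
  basic neighbourhood in the product topology imposes only \<open>n\<close> conditions and a minimum
  of finitely many radii works.\<close>

lemma Rn_open_contains_box:
  assumes "openin (top_of_set (Rn n)) W" "y \<in> W"
  shows "\<exists>e>0. \<forall>z\<in>Rn n. (\<forall>j<n. \<bar>z j - y j\<bar> < e) \<longrightarrow> z \<in> W"
proof -
  obtain G where G: "open G" "W = Rn n \<inter> G" using assms(1) by (auto simp: openin_open)
  have "openin (product_topology (\<lambda>_::nat. euclideanreal) UNIV) G"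
    using G(1) by (simp add: euclidean_product_topology)
  moreover have "y \<in> G" using assms(2) G by auto
  ultimately obtain B where B: "y \<in> (\<Pi>\<^sub>E i\<in>UNIV. B i)" "\<And>i. open (B i)" "(\<Pi>\<^sub>E i\<in>UNIV. B i) \<subseteq> G"
    using product_topology_open_contains_basis[of "\<lambda>_. euclideanreal" UNIV G y] by auto
  have "\<exists>d>0. ball (y i) d \<subseteq> B i" for i
    using B(1,2) by (auto simp: PiE_iff open_contains_ball)
  then obtain d where d: "\<And>i. d i > 0" "\<And>i. ball (y i) (d i) \<subseteq> B i" by metis
  \<comment> \<open>\<open>insert 1\<close> keeps the minimum meaningful for
    \<open>n = 0\<close>.\<close>
  define e where "e = Min (insert 1 (d ` {..<n}))"
  have e: "e > 0" "\<And>j. j < n \<Longrightarrow> e \<le> d j" by (auto simp: e_def d(1))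
  have "z \<in> W" if z: "z \<in> Rn n" "\<forall>j<n. \<bar>z j - y j\<bar> < e" for z
  proof -
    have "z j \<in> B j" for j
    proof (cases "j < n")
      case True
      then have "\<bar>z j - y j\<bar> < d j" using z(2) e(2) by fastforce
      then show ?thesis using d(2)[of j] by (auto simp: dist_real_def abs_minus_commute)
    next
      case False
      then have "z j = y j" using z(1) assms(2) G(2) by (auto simp: Rn_def)
      then show ?thesis using B(1) by (auto simp: PiE_iff)
    qed
    then show ?thesis using B(3) G z(1) by (auto simp: PiE_iff)
  qed
  then show ?thesis using e(1) by blast
qed

lemma tendsto_fun_coordinatewise:
  fixes f :: "'b \<Rightarrow> 'c \<Rightarrow> real"
  assumes "\<And>i. ((\<lambda>x. f x i) \<longlongrightarrow> l i) F"
  shows "(f \<longlongrightarrow> l) F"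
  using limitin_componentwise[of "\<lambda>_. euclideanreal" UNIV f l F] assms
  by (simp add: euclidean_product_topology)

lemma Ck_imp_continuous_on: "Ck k n U g \<Longrightarrow> continuous_on U g"
  by (cases k) auto

lemma has_partial_imp_DERIV:
  assumes "has_partial i g (z(i := u))"
  shows "((\<lambda>u. g (z(i := u))) has_real_derivative partial_deriv i g (z(i := u))) (at u)"
proof -
  have "((\<lambda>s. g (z(i := u + s))) has_real_derivative partial_deriv i g (z(i := u))) (at 0)"
    using assms by (simp add: has_partial_def partial_deriv_def DERIV_deriv_iff_real_differentiable)
  then show ?thesis
    using DERIV_shift[of "\<lambda>u. g (z(i := u))" "partial_deriv i g (z(i := u))" 0 u]
    by (simp add: add.commute)
qed

lemma MVT_either_direction:
  fixes F :: "real \<Rightarrow> real"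
  assumes "\<And>u. \<bar>u - p\<bar> \<le> \<bar>q - p\<bar> \<Longrightarrow> (F has_real_derivative F' u) (at u)"
  shows "\<exists>u. \<bar>u - p\<bar> \<le> \<bar>q - p\<bar> \<and> F q - F p = (q - p) * F' u"
proof -
  consider "p < q" | "p = q" | "q < p" by linarith
  then show ?thesis
  proof cases
    case 1
    then obtain u where "p < u" "u < q" "F q - F p = (q - p) * F' u"
      using MVT2[of p q F F'] assms by auto
    then show ?thesis by (intro exI[of _ u]) auto
  next
    case 3
    then obtain u where "q < u" "u < p" "F p - F q = (p - q) * F' u"
      using MVT2[of q p F F'] assms by auto
    then show ?thesis by (intro exI[of _ u]) (auto simp: algebra_simps)
  qed auto
qed

text \<open>The classical argument from continuous partial derivatives: pass from
  \<open>\<gamma> s\<close> to \<open>\<gamma> r\<close> one coordinate at a time, apply the mean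
  value theorem to each change, and let \<open>r\<close> tend to \<open>s\<close>.\<close>

lemma has_derivative_along_curve:
  assumes W: "openin (top_of_set (Rn n)) W"
    and part: "\<And>i x. i < n \<Longrightarrow> x \<in> W \<Longrightarrow> has_partial i g x"
    and cont: "\<And>i. i < n \<Longrightarrow> continuous_on W (partial_deriv i g)"
    and S: "open S" "s \<in> S" and \<gamma>: "\<And>r. r \<in> S \<Longrightarrow> \<gamma> r \<in> W"
    and der: "\<And>i. i < n \<Longrightarrow> ((\<lambda>r. \<gamma> r i) has_real_derivative \<gamma>' i) (at s)"
  shows "((\<lambda>r. g (\<gamma> r)) has_real_derivative (\<Sum>i<n. \<gamma>' i * partial_deriv i g (\<gamma> s))) (at s)"
proof -
  define y where "y = \<gamma> s"
  have yW: "y \<in> W" using \<gamma> S by (simp add: y_def)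
  have WR: "W \<subseteq> Rn n" using W openin_imp_subset by blast
  obtain e where e: "e > 0" "\<And>z. z \<in> Rn n \<Longrightarrow> (\<And>j. j < n \<Longrightarrow> \<bar>z j - y j\<bar> < e) \<Longrightarrow> z \<in> W"
    using Rn_open_contains_box[OF W yW] by metis
  have lim: "((\<lambda>r. \<gamma> r j) \<longlongrightarrow> y j) (at s)" if "j < n" for j
    using DERIV_isCont[OF der[OF that]] by (simp add: isCont_def y_def)
  define good where "good r \<longleftrightarrow> r \<in> S \<and> (\<forall>j<n. \<bar>\<gamma> r j - y j\<bar> < e)" for r
  have "\<forall>\<^sub>F r in at s. \<forall>j\<in>{..<n}. \<bar>\<gamma> r j - y j\<bar> < e"
    using lim e(1) by (intro eventually_ball_finite) (auto simp: tendsto_iff dist_real_def)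
  moreover have "\<forall>\<^sub>F r in at s. r \<in> S" using S eventually_at_topological by blast
  ultimately have ev: "\<forall>\<^sub>F r in at s. good r" by eventually_elim (auto simp: good_def)
  define z where "z i r = (\<lambda>j. if j < i then \<gamma> r j else y j)" for i r
  have z_upd: "z (Suc i) r = (z i r)(i := \<gamma> r i)" "z i r = (z i r)(i := y i)" for i r
    by (auto simp: z_def less_Suc_eq)
  have inW: "(z i r)(i := u) \<in> W" if "good r" "i < n" "\<bar>u - y i\<bar> \<le> \<bar>\<gamma> r i - y i\<bar>" for i r u
  proof (rule e(2))
    have "\<gamma> r \<in> Rn n" "y \<in> Rn n" using that \<gamma> WR yW by (auto simp: good_def)
    then show "(z i r)(i := u) \<in> Rn n" using that by (auto simp: z_def Rn_def)
    show "\<bar>((z i r)(i := u)) j - y j\<bar> < e" if "j < n" for j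
      using that \<open>good r\<close> \<open>\<bar>u - y i\<bar> \<le> _\<close> e(1) by (auto simp: z_def good_def)
  qed
  have "\<exists>u. \<bar>u - y i\<bar> \<le> \<bar>\<gamma> r i - y i\<bar> \<and>
      g (z (Suc i) r) - g (z i r) = (\<gamma> r i - y i) * partial_deriv i g ((z i r)(i := u))"
    if "good r" "i < n" for i r
  proof -
    have "\<exists>u. \<bar>u - y i\<bar> \<le> \<bar>\<gamma> r i - y i\<bar> \<and> g ((z i r)(i := \<gamma> r i)) - g ((z i r)(i := y i)) =
        (\<gamma> r i - y i) * partial_deriv i g ((z i r)(i := u))"
      by (rule MVT_either_direction[where F="\<lambda>u. g ((z i r)(i := u))"])
         (intro has_partial_imp_DERIV part inW that)
    then show ?thesis using z_upd by metis
  qed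
  then obtain U where U: "\<And>r i. good r \<Longrightarrow> i < n \<Longrightarrow> \<bar>U r i - y i\<bar> \<le> \<bar>\<gamma> r i - y i\<bar>"
      "\<And>r i. good r \<Longrightarrow> i < n \<Longrightarrow> g (z (Suc i) r) - g (z i r) =
          (\<gamma> r i - y i) * partial_deriv i g ((z i r)(i := U r i))"
    by metis
  \<comment> \<open>The default \<open>y\<close> at the remaining times keeps
    \<open>\<xi> i r\<close> in \<open>W\<close> throughout, where the partial derivatives are
    continuous.\<close>
  define \<xi> where "\<xi> i r = (if good r then (z i r)(i := U r i) else y)" for i r
  have \<xi>W: "\<xi> i r \<in> W" if "i < n" for i r
    using inW[OF _ that U(1)[OF _ that]] yW by (auto simp: \<xi>_def)
  have \<xi>_lim: "(\<xi> i \<longlongrightarrow> y) (at s)" if i: "i < n" for i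
  proof (rule tendsto_fun_coordinatewise)
    fix j
    show "((\<lambda>r. \<xi> i r j) \<longlongrightarrow> y j) (at s)"
    proof (cases "j < n")
      case True
      have "((\<lambda>r. \<gamma> r j - y j) \<longlongrightarrow> 0) (at s)" using lim[OF True] by (simp add: LIM_zero)
      then have "((\<lambda>r. \<xi> i r j - y j) \<longlongrightarrow> 0) (at s)"
        by (rule Lim_null_comparison[rotated, OF tendsto_norm_zero])
           (use U(1) i in \<open>auto simp: \<xi>_def z_def intro!: always_eventually\<close>)
      then show ?thesis by (simp add: LIM_zero_iff)
    next
      case False
      moreover have "\<xi> i r \<in> Rn n" "y \<in> Rn n" for r using \<xi>W[OF i] WR yW by auto
      ultimately have "\<xi> i r j = y j" for r by (simp add: Rn_def)
      then show ?thesis by simp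
    qed
  qed
  have "((\<lambda>r. \<Sum>i<n. (\<gamma> r i - y i) / (r - s) * partial_deriv i g (\<xi> i r)) \<longlongrightarrow>
      (\<Sum>i<n. \<gamma>' i * partial_deriv i g y)) (at s)"
  proof (intro tendsto_sum tendsto_mult)
    fix i assume "i \<in> {..<n}"
    then have i: "i < n" by simp
    show "((\<lambda>r. (\<gamma> r i - y i) / (r - s)) \<longlongrightarrow> \<gamma>' i) (at s)"
      using der[OF i] by (simp add: has_field_derivative_iff y_def)
    show "((\<lambda>r. partial_deriv i g (\<xi> i r)) \<longlongrightarrow> partial_deriv i g y) (at s)"
      by (rule continuous_on_tendsto_compose[OF cont[OF i] \<xi>_lim[OF i] yW])
         (simp add: \<xi>W[OF i])
  qed
  moreover have "\<forall>\<^sub>F r in at s. (\<Sum>i<n. (\<gamma> r i - y i) / (r - s) * partial_deriv i g (\<xi> i r)) =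
      (g (\<gamma> r) - g y) / (r - s)"
    using ev
  proof eventually_elim
    case (elim r)
    have "\<gamma> r \<in> Rn n" "y \<in> Rn n" using elim \<gamma> WR yW by (auto simp: good_def)
    then have "z n r = \<gamma> r" by (auto simp: z_def Rn_def fun_eq_iff)
    moreover have "z 0 r = y" by (simp add: z_def)
    ultimately have "g (\<gamma> r) - g y = (\<Sum>i<n. g (z (Suc i) r) - g (z i r))"
      using sum_lessThan_telescope[of "\<lambda>i. g (z i r)" n] by simp
    also have "\<dots> = (\<Sum>i<n. (\<gamma> r i - y i) * partial_deriv i g (\<xi> i r))"
      using U(2)[OF elim] elim by (intro sum.cong) (auto simp: \<xi>_def)
    finally show ?case by (simp add: sum_divide_distrib)
  qed
  ultimately have "((\<lambda>r. (g (\<gamma> r) - g y) / (r - s)) \<longlongrightarrow> (\<Sum>i<n. \<gamma>' i * partial_deriv i g y)) (at s)"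
    by (rule Lim_transform_eventually)
  then show ?thesis by (simp add: has_field_derivative_iff y_def)
qed

text \<open>The chain rule gives a sum of products of coordinate derivatives with partial
  derivatives of \<open>g\<close> along the same curve; these partial derivatives satisfy
  \<open>Ck k\<close>, so the induction hypothesis applies to them.\<close>

lemma times_differentiable_on_along_curve:
  assumes W: "openin (top_of_set (Rn n)) W" and S: "open S" and \<gamma>: "\<And>r. r \<in> S \<Longrightarrow> \<gamma> r \<in> W"
  shows "Ck k n W g \<Longrightarrow> (\<And>i. i < n \<Longrightarrow> times_differentiable_on k S (\<lambda>r. \<gamma> r i))
    \<Longrightarrow> times_differentiable_on k S (\<lambda>r. g (\<gamma> r))"
proof (induction k arbitrary: g)
  case (Suc k)
  have "\<forall>i. \<exists>c'. i < n \<longrightarrow> (\<forall>x\<in>S. ((\<lambda>r. \<gamma> r i) has_real_derivative c' x) (at x))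
      \<and> times_differentiable_on k S c'"
    using Suc.prems(2) by auto
  then obtain \<gamma>' where \<gamma>': "\<And>i x. i < n \<Longrightarrow> x \<in> S \<Longrightarrow> ((\<lambda>r. \<gamma> r i) has_real_derivative \<gamma>' i x) (at x)"
      "\<And>i. i < n \<Longrightarrow> times_differentiable_on k S (\<gamma>' i)"
    by metis
  have "times_differentiable_on k S (\<lambda>r. partial_deriv i g (\<gamma> r))" if "i < n" for i
    by (rule Suc.IH) (use Suc.prems(1) that in simp, rule times_differentiable_on_Suc_D[OF Suc.prems(2)])
  then have "times_differentiable_on k S (\<lambda>r. \<Sum>i<n. \<gamma>' i r * partial_deriv i g (\<gamma> r))"
    using \<gamma>'(2) by (intro times_differentiable_on_sum times_differentiable_on_mult) auto
  moreover have "((\<lambda>r. g (\<gamma> r)) has_real_derivative (\<Sum>i<n. \<gamma>' i r * partial_deriv i g (\<gamma> r))) (at r)"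
    if "r \<in> S" for r
    using Suc.prems(1) that
    by (intro has_derivative_along_curve[OF W _ _ S _ \<gamma>] \<gamma>'(1))
       (auto intro: Ck_imp_continuous_on)
  ultimately show ?case
    by (intro times_differentiable_onI[where f'="\<lambda>r. \<Sum>i<n. \<gamma>' i r * partial_deriv i g (\<gamma> r)"])
qed auto

section \<open>Topology of charts\<close>

lemma chart_on_inj: "chart_on X n \<phi> U \<Longrightarrow> inj_on \<phi> U"
  unfolding chart_on_def
  by (metis homeomorphic_imp_injective_map openin_subset topspace_subtopology_subset)

lemma chart_on_continuous: "chart_on X n \<phi> U \<Longrightarrow> continuous_map (subtopology X U) euclidean \<phi>"
  unfolding chart_on_def
  by (metis continuous_map_into_fulltopology homeomorphic_imp_continuous_map)

text \<open>The inverse is taken as \<open>inv_into U \<phi>\<close> because transition maps have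
  this form in \<open>smooth_manifold\<close>.\<close>

lemma chart_on_inverse_continuous:
  assumes "chart_on X n \<phi> U"
  shows "continuous_map (top_of_set (\<phi> ` U)) X (inv_into U \<phi>)"
proof -
  have U: "topspace (subtopology X U) = U"
    using assms unfolding chart_on_def by (meson openin_subset topspace_subtopology_subset)
  obtain g where g: "homeomorphic_maps (subtopology X U) (top_of_set (\<phi> ` U)) \<phi> g"
    using assms by (auto simp: chart_on_def homeomorphic_map_maps)
  then have "continuous_map (top_of_set (\<phi> ` U)) X g"
    using continuous_map_into_fulltopology unfolding homeomorphic_maps_def by blast
  moreover have "g y = inv_into U \<phi> y" if "y \<in> \<phi> ` U" for y
    using that g U chart_on_inj[OF assms] by (auto simp: homeomorphic_maps_def)
  ultimately show ?thesis by (auto intro: continuous_map_eq)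
qed

lemma chart_on_image_open:
  assumes "chart_on X n \<phi> U" "openin X V"
  shows "openin (top_of_set (Rn n)) (\<phi> ` (U \<inter> V))"
proof -
  have "openin (subtopology X U) (U \<inter> V)"
    using assms by (simp add: openin_subtopology_Int2)
  then have "openin (top_of_set (\<phi> ` U)) (\<phi> ` (U \<inter> V))"
    using assms(1) homeomorphic_imp_open_map unfolding chart_on_def open_map_def by blast
  then show ?thesis using assms(1) openin_trans unfolding chart_on_def by blast
qed

lemma chart_on_box_open:
  assumes "chart_on X n \<phi> U"
  shows "openin X {p \<in> U. \<forall>j<n. \<bar>\<phi> p j - q j\<bar> < e}"
proof -
  have "open {z::nat \<Rightarrow> real. \<bar>z j - q j\<bar> < e}" for j
    by (intro open_Collect_less continuous_intros) auto
  then have "open (\<Inter>j<n. {z::nat \<Rightarrow> real. \<bar>z j - q j\<bar> < e})" by (intro open_INT) auto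
  then have "openin euclidean (\<Inter>j<n. {z::nat \<Rightarrow> real. \<bar>z j - q j\<bar> < e})" by simp
  from openin_continuous_map_preimage[OF chart_on_continuous[OF assms] this]
  have "openin (subtopology X U)
      {p \<in> topspace (subtopology X U). \<phi> p \<in> (\<Inter>j<n. {z::nat \<Rightarrow> real. \<bar>z j - q j\<bar> < e})}" .
  moreover have "openin X U" using assms by (simp add: chart_on_def)
  moreover from this have "{p \<in> topspace (subtopology X U). \<phi> p \<in> (\<Inter>j<n. {z. \<bar>z j - q j\<bar> < e})}
      = {p \<in> U. \<forall>j<n. \<bar>\<phi> p j - q j\<bar> < e}"
    using openin_subset by fastforce
  ultimately show ?thesis by (simp add: openin_open_subtopology)
qed

section \<open>Building and gluing smooth curves\<close>

lemma smooth_curve_const: "p \<in> topspace X \<Longrightarrow> smooth_curve X A (\<lambda>_. p)"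
  by (auto simp: smooth_curve_def smooth_real_const)

lemma smooth_curve_in_topspace: "smooth_curve X A c \<Longrightarrow> c s \<in> topspace X"
  by (auto simp: smooth_curve_def continuous_map_def)

text \<open>Agreement on an open interval around \<open>m\<close> makes the glued curve coincide
  near every time with \<open>c1\<close> or with \<open>c2\<close>, so there are no derivatives to
  match at \<open>m\<close>.\<close>

lemma smooth_curve_glue:
  assumes ch: "\<And>\<phi> U. (\<phi>, U) \<in> A \<Longrightarrow> openin X U"
    and c1: "smooth_curve X A c1" and c2: "smooth_curve X A c2"
    and m: "l < m" "m < r" and eq: "\<And>s. l < s \<Longrightarrow> s < r \<Longrightarrow> c1 s = c2 s"
  shows "smooth_curve X A (\<lambda>s. if s \<le> m then c1 s else c2 s)"
proof -
  define c where "c s = (if s \<le> m then c1 s else c2 s)" for s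
  have e1: "c s = c1 s" if "s < r" for s using that eq m by (auto simp: c_def)
  have e2: "c s = c2 s" if "s > l" for s using that eq m by (auto simp: c_def)
  have op: "open {s. c1 s \<in> V}" "open {s. c2 s \<in> V}" if "openin X V" for V
    using c1 c2 that by (auto simp: smooth_curve_def continuous_map_def)
  have "c s \<in> V \<longleftrightarrow> c1 s \<in> V \<and> s < r \<or> c2 s \<in> V \<and> s > l" for s V
  proof -
    have "s < r \<or> s > l" using m by linarith
    then show ?thesis using e1[of s] e2[of s] by auto
  qed
  then have "{s. c s \<in> V} = ({s. c1 s \<in> V} \<inter> {..<r}) \<union> ({s. c2 s \<in> V} \<inter> {l<..})" for V
    by auto
  then have "open {s. c s \<in> V}" if "openin X V" for V
    using op[OF that] by (metis open_Int open_Un open_greaterThan open_lessThan)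
  moreover have "c s \<in> topspace X" for s
    using smooth_curve_in_topspace[OF c1] smooth_curve_in_topspace[OF c2] by (simp add: c_def)
  ultimately have "continuous_map euclideanreal X c" by (auto simp: continuous_map_def)
  moreover have "smooth_real {s. c s \<in> U} (\<lambda>s. \<phi> (c s) j)" if A: "(\<phi>, U) \<in> A" for \<phi> U j
  proof (rule smooth_real_local)
    have sm: "smooth_real {s. c1 s \<in> U} (\<lambda>s. \<phi> (c1 s) j)" "smooth_real {s. c2 s \<in> U} (\<lambda>s. \<phi> (c2 s) j)"
      using c1 c2 A by (auto simp: smooth_curve_def)
    fix s assume s: "s \<in> {s. c s \<in> U}"
    show "\<exists>N g. open N \<and> s \<in> N \<and> (\<forall>y\<in>N. \<phi> (c y) j = g y) \<and> smooth_real N g"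
    proof (cases "s < r")
      case True
      show ?thesis
        by (rule exI[of _ "{s. c1 s \<in> U} \<inter> {..<r}"], rule exI[of _ "\<lambda>s. \<phi> (c1 s) j"])
           (use True s e1 sm(1) op(1)[OF ch[OF A]] in \<open>auto simp: smooth_real_def\<close>)
    next
      case False
      then have "s > l" using m by linarith
      then show ?thesis
        by (intro exI[of _ "{s. c2 s \<in> U} \<inter> {l<..}"] exI[of _ "\<lambda>s. \<phi> (c2 s) j"])
           (use s e2 sm(2) op(2)[OF ch[OF A]] in \<open>auto simp: smooth_real_def\<close>)
    qed
  qed
  ultimately show ?thesis unfolding c_def[abs_def] smooth_curve_def by blast
qed

context
  fixes X :: "'a topology" and n :: nat and A :: "(('a \<Rightarrow> nat \<Rightarrow> real) \<times> 'a set) set"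
  assumes manifold: "smooth_manifold X n A"
begin

lemma atlas_chart: "(\<phi>, U) \<in> A \<Longrightarrow> chart_on X n \<phi> U"
  using manifold by (auto simp: smooth_manifold_def)

lemma atlas_open: "(\<phi>, U) \<in> A \<Longrightarrow> openin X U"
  using atlas_chart by (auto simp: chart_on_def)

lemma atlas_covers: "p \<in> topspace X \<Longrightarrow> \<exists>\<phi> U. (\<phi>, U) \<in> A \<and> p \<in> U"
  using manifold unfolding smooth_manifold_def by blast

lemma atlas_smooth:
  "(\<phi>, U) \<in> A \<Longrightarrow> (\<psi>, V) \<in> A \<Longrightarrow> j < n \<Longrightarrow> smooth_fun n (\<phi> ` (U \<inter> V)) (\<lambda>y. \<psi> (inv_into U \<phi> y) j)"
  using manifold unfolding smooth_manifold_def by blast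

lemma chart_coordinate_eq_0: "(\<phi>, U) \<in> A \<Longrightarrow> p \<in> U \<Longrightarrow> j \<ge> n \<Longrightarrow> \<phi> p j = 0"
  using atlas_chart[of \<phi> U] unfolding chart_on_def Rn_def by blast

text \<open>Smoothness in the other charts of the atlas follows from the chain rule applied to the
  transition maps.\<close>

lemma chart_curve_smooth:
  assumes A: "(\<phi>, U) \<in> A" and \<gamma>: "\<And>s. \<gamma> s \<in> \<phi> ` U"
    and sm: "\<And>j. j < n \<Longrightarrow> smooth_real UNIV (\<lambda>s. \<gamma> s j)"
  shows "smooth_curve X A (\<lambda>s. inv_into U \<phi> (\<gamma> s))"
proof -
  define c where "c s = inv_into U \<phi> (\<gamma> s)" for s
  have cU: "c s \<in> U" "\<phi> (c s) = \<gamma> s" for s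
    using \<gamma> by (simp_all add: c_def inv_into_into f_inv_into_f)
  have "continuous_on UNIV (\<lambda>s. \<gamma> s j)" for j
  proof (cases "j < n")
    case True
    then show ?thesis
      using smooth_real_has_deriv[OF sm[OF True] UNIV_I, of 0]
      by (intro continuous_at_imp_continuous_on ballI DERIV_isCont) auto
  next
    case False
    then have "\<gamma> s j = 0" for s using chart_coordinate_eq_0[OF A cU(1)] cU(2) by (metis not_less)
    then show ?thesis by simp
  qed
  then have "continuous_on UNIV \<gamma>" by (rule continuous_on_coordinatewise_then_product)
  then have "continuous_map euclideanreal (top_of_set (\<phi> ` U)) \<gamma>"
    using \<gamma> by (auto simp: continuous_map_in_subtopology)
  from continuous_map_compose[OF this chart_on_inverse_continuous[OF atlas_chart[OF A]]]
  have cont: "continuous_map euclideanreal X c" by (simp add: c_def[abs_def] comp_def)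
  moreover have "smooth_real {s. c s \<in> V} (\<lambda>s. \<psi> (c s) j)" if B: "(\<psi>, V) \<in> A" for \<psi> V j
  proof -
    have op: "open {s. c s \<in> V}"
      using cont atlas_open[OF B] by (auto simp: continuous_map_def)
    show ?thesis
    proof (cases "j < n")
      case True
      have "times_differentiable_on k {s. c s \<in> V} (\<lambda>s. \<psi> (inv_into U \<phi> (\<gamma> s)) j)" for k
      proof (rule times_differentiable_on_along_curve[OF chart_on_image_open[OF atlas_chart[OF A] atlas_open[OF B]] op,
            where g="\<lambda>y. \<psi> (inv_into U \<phi> y) j"])
        show "\<gamma> s \<in> \<phi> ` (U \<inter> V)" if "s \<in> {s. c s \<in> V}" for s
          using that cU[of s] by (metis (no_types, lifting) IntI imageI mem_Collect_eq)
        show "Ck k n (\<phi> ` (U \<inter> V)) (\<lambda>y. \<psi> (inv_into U \<phi> y) j)"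
          using atlas_smooth[OF A B True] by (simp add: smooth_fun_def)
        show "times_differentiable_on k {s. c s \<in> V} (\<lambda>r. \<gamma> r i)" if "i < n" for i
          using smooth_real_imp_times_differentiable_on[of "{s. c s \<in> V}"] sm[OF that]
          by (auto simp: smooth_real_def)
      qed
      then show ?thesis unfolding smooth_real_iff[OF op] by (simp add: c_def)
    next
      \<comment> \<open>\<open>smooth_curve\<close> ranges over all \<open>j\<close>, and the
        coordinates from \<open>n\<close> on are identically zero in the chart domain.\<close>
      case False
      then have "\<psi> (c s) j = 0" if "c s \<in> V" for s using chart_coordinate_eq_0[OF B that] by simp
      then show ?thesis
        by (intro smooth_real_local exI[of _ "{s. c s \<in> V}"] exI[of _ "\<lambda>_. 0"])
           (auto simp: op smooth_real_const)
    qed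
  qed
  ultimately show ?thesis unfolding smooth_curve_def c_def[abs_def] by blast
qed

lemma chart_contains_box:
  assumes "(\<phi>, U) \<in> A" "p \<in> U"
  shows "\<exists>e>0. \<forall>z\<in>Rn n. (\<forall>j<n. \<bar>z j - \<phi> p j\<bar> < e) \<longrightarrow> z \<in> \<phi> ` U"
  using Rn_open_contains_box[of n "\<phi> ` U" "\<phi> p"] atlas_chart[OF assms(1)] assms(2)
  by (auto simp: chart_on_def)

text \<open>Constancy outside \<open>[a, b]\<close> turns concatenation into gluing, and asking for
  all \<open>a < b\<close> spares reparametrisation.\<close>

definition smoothly_joined :: "'a \<Rightarrow> 'a \<Rightarrow> bool" where
  "smoothly_joined p q \<longleftrightarrow>
     (\<forall>a b. a < b \<longrightarrow> (\<exists>c. smooth_curve X A c \<and> (\<forall>s\<le>a. c s = p) \<and> (\<forall>s\<ge>b. c s = q)))"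

lemma smoothly_joined_trans:
  assumes "smoothly_joined p q" "smoothly_joined q r"
  shows "smoothly_joined p r"
  unfolding smoothly_joined_def
proof (intro allI impI)
  fix a b :: real assume "a < b"
  \<comment> \<open>Both curves rest at \<open>q\<close> on \<open>(m1, m2)\<close>, which is the
    overlap around \<open>m\<close> required for gluing.\<close>
  define m1 m m2 where "m1 = a + (b - a) / 4" and "m = a + (b - a) / 2" and "m2 = a + 3 * (b - a) / 4"
  have m: "a < m1" "m1 < m" "m < m2" "m2 < b" using \<open>a < b\<close> by (auto simp: m1_def m_def m2_def field_simps)
  obtain c1 where c1: "smooth_curve X A c1" "\<forall>s\<le>a. c1 s = p" "\<forall>s\<ge>m1. c1 s = q"
    using assms(1) m(1) unfolding smoothly_joined_def by blast
  obtain c2 where c2: "smooth_curve X A c2" "\<forall>s\<le>m2. c2 s = q" "\<forall>s\<ge>b. c2 s = r"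
    using assms(2) m(4) unfolding smoothly_joined_def by blast
  have "smooth_curve X A (\<lambda>s. if s \<le> m then c1 s else c2 s)"
    by (rule smooth_curve_glue[OF atlas_open c1(1) c2(1) m(2,3)]) (use c1 c2 in auto)
  then show "\<exists>c. smooth_curve X A c \<and> (\<forall>s\<le>a. c s = p) \<and> (\<forall>s\<ge>b. c s = r)"
    by (intro exI[of _ "\<lambda>s. if s \<le> m then c1 s else c2 s"]) (use c1 c2 m in auto)
qed

text \<open>A coordinate box around \<open>p\<close> is convex, and \<open>step_between\<close>
  traverses the segment between two of its points with rests at both ends.\<close>

lemma locally_smoothly_joined:
  assumes "p \<in> topspace X"
  shows "\<exists>W. openin X W \<and> p \<in> W \<and> (\<forall>q1\<in>W. \<forall>q2\<in>W. smoothly_joined q1 q2)"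
proof -
  obtain \<phi> U where A: "(\<phi>, U) \<in> A" and p: "p \<in> U" using atlas_covers[OF assms] by blast
  obtain e where e: "e > 0" "\<And>z. z \<in> Rn n \<Longrightarrow> (\<And>j. j < n \<Longrightarrow> \<bar>z j - \<phi> p j\<bar> < e) \<Longrightarrow> z \<in> \<phi> ` U"
    using chart_contains_box[OF A p] by metis
  define W where "W = {q \<in> U. \<forall>j<n. \<bar>\<phi> q j - \<phi> p j\<bar> < e}"
  have "smoothly_joined q1 q2" if q: "q1 \<in> W" "q2 \<in> W" for q1 q2
    unfolding smoothly_joined_def
  proof (intro allI impI)
    fix a b :: real assume ab: "a < b"
    define \<gamma> where "\<gamma> s j = \<phi> q1 j + step_between a b s * (\<phi> q2 j - \<phi> q1 j)" for s j
    have "\<gamma> s \<in> \<phi> ` U" for s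
    proof (rule e(2))
      show "\<gamma> s \<in> Rn n"
        using q chart_coordinate_eq_0[OF A] by (simp add: \<gamma>_def W_def Rn_def)
      fix j assume "j < n"
      then have "\<phi> q1 j \<in> ball (\<phi> p j) e" "\<phi> q2 j \<in> ball (\<phi> p j) e"
        using q by (auto simp: W_def dist_real_def abs_minus_commute)
      then have "(1 - step_between a b s) *\<^sub>R \<phi> q1 j + step_between a b s *\<^sub>R \<phi> q2 j \<in> ball (\<phi> p j) e"
        using convexD_alt[OF convex_ball] step_between_bounds by blast
      then show "\<bar>\<gamma> s j - \<phi> p j\<bar> < e"
        by (simp add: \<gamma>_def dist_real_def algebra_simps abs_minus_commute)
    qed
    moreover have "smooth_real UNIV (\<lambda>s. \<gamma> s j)" for j
      unfolding \<gamma>_def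
      by (simp add: smooth_real_iff times_differentiable_on_add times_differentiable_on_mult
          times_differentiable_on_const times_differentiable_on_step_between)
    ultimately have "smooth_curve X A (\<lambda>s. inv_into U \<phi> (\<gamma> s))" by (intro chart_curve_smooth[OF A])
    moreover have "\<gamma> s = \<phi> q1" if "s \<le> a" for s
      using step_between_eq_0[OF ab that] by (auto simp: \<gamma>_def)
    moreover have "\<gamma> s = \<phi> q2" if "s \<ge> b" for s
      using step_between_eq_1[OF ab that] by (auto simp: \<gamma>_def)
    ultimately show "\<exists>c. smooth_curve X A c \<and> (\<forall>s\<le>a. c s = q1) \<and> (\<forall>s\<ge>b. c s = q2)"
      by (intro exI[of _ "\<lambda>s. inv_into U \<phi> (\<gamma> s)"]) (use q chart_on_inj[OF atlas_chart[OF A]] in \<open>auto simp: W_def\<close>)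
  qed
  moreover have "openin X W" unfolding W_def by (rule chart_on_box_open[OF atlas_chart[OF A]])
  moreover have "p \<in> W" using p e(1) by (simp add: W_def)
  ultimately show ?thesis by blast
qed

text \<open>The points joined to \<open>p\<close> form a set that is open and closed, by local
  joinability and transitivity.\<close>

lemma connected_smoothly_joined:
  assumes conn: "connected_space X" and p: "p \<in> topspace X" and q: "q \<in> topspace X"
  shows "smoothly_joined p q"
proof -
  define S where "S = {q \<in> topspace X. smoothly_joined p q}"
  have "openin X S"
    unfolding openin_subopen[of X S]
  proof
    fix q assume q: "q \<in> S"
    then have "q \<in> topspace X" by (simp add: S_def)
    from locally_smoothly_joined[OF this] obtain W
      where W: "openin X W" "q \<in> W" "\<forall>q1\<in>W. \<forall>q2\<in>W. smoothly_joined q1 q2" by blast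
    have "W \<subseteq> S"
      using W q openin_subset[OF W(1)] smoothly_joined_trans[of p q] by (auto simp: S_def)
    then show "\<exists>T. openin X T \<and> q \<in> T \<and> T \<subseteq> S" using W by blast
  qed
  moreover have "openin X (topspace X - S)"
    unfolding openin_subopen[of X "topspace X - S"]
  proof
    fix q assume q: "q \<in> topspace X - S"
    obtain W where W: "openin X W" "q \<in> W" "\<forall>q1\<in>W. \<forall>q2\<in>W. smoothly_joined q1 q2"
      using locally_smoothly_joined q by blast
    have "W \<subseteq> topspace X - S"
      using W q openin_subset[OF W(1)] smoothly_joined_trans unfolding S_def by blast
    then show "\<exists>T. openin X T \<and> q \<in> T \<and> T \<subseteq> topspace X - S" using W by blast
  qed
  moreover have "p \<in> S"
    using locally_smoothly_joined[OF p] p unfolding S_def by blast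
  moreover have "S \<subseteq> topspace X" by (auto simp: S_def)
  ultimately have "openin X S" "closedin X S" "S \<noteq> {}" by (auto simp: closedin_def)
  then have "S = topspace X" using conn unfolding connected_space_clopen_in by blast
  then show ?thesis using q by (auto simp: S_def)
qed

section \<open>Curves through rapidly convergent sequences\<close>

text \<open>Speed is measured in some chart around the limit. Only the tail counts, so the earlier
  members may lie anywhere.\<close>

definition rapidly_converges :: "(nat \<Rightarrow> real) \<Rightarrow> (nat \<Rightarrow> 'a) \<Rightarrow> 'a \<Rightarrow> bool" where
  "rapidly_converges \<delta> x p \<longleftrightarrow> (\<exists>\<phi> U. (\<phi>, U) \<in> A \<and> p \<in> U \<and>
     (\<forall>\<^sub>F k in sequentially. x k \<in> U \<and> (\<forall>j<n. \<bar>\<phi> (x k) j - \<phi> p j\<bar> < \<delta> k)))"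

lemma rapidly_converges_eventually_const:
  assumes "p \<in> topspace X" "\<And>k. \<delta> k > 0" "\<forall>\<^sub>F k in sequentially. x k = p"
  shows "rapidly_converges \<delta> x p"
proof -
  obtain \<phi> U where "(\<phi>, U) \<in> A" "p \<in> U" using atlas_covers[OF assms(1)] by blast
  moreover from this have "\<forall>\<^sub>F k in sequentially. x k \<in> U \<and> (\<forall>j<n. \<bar>\<phi> (x k) j - \<phi> p j\<bar> < \<delta> k)"
    using assms(3) by (auto elim!: eventually_mono simp: assms(2))
  ultimately show ?thesis unfolding rapidly_converges_def by blast
qed

lemma rapidly_converges_within_chart:
  assumes "(\<phi>, U) \<in> A" "p \<in> U" "\<And>k. k \<ge> N \<Longrightarrow> x k \<in> {q \<in> U. \<forall>j<n. \<bar>\<phi> q j - \<phi> p j\<bar> < \<delta> k}"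
  shows "rapidly_converges \<delta> x p"
  unfolding rapidly_converges_def eventually_sequentially using assms by blast

text \<open>Each chart coordinate is interpolated separately; a late start \<open>N\<close> keeps
  the coordinate curve in a box inside the image of the chart.\<close>

lemma smooth_curve_through_rapid_tail:
  assumes rate: "interpolation_rate a \<delta>" and rapid: "rapidly_converges \<delta> x p"
  shows "\<exists>N c. smooth_curve X A c \<and> (\<forall>s\<le>0. c s = p) \<and> (\<forall>k\<ge>N. c (a k) = x k) \<and> (\<forall>s\<ge>a N. c s = x N)"
proof -
  obtain \<phi> U N0 where A: "(\<phi>, U) \<in> A" and p: "p \<in> U"
    and x: "\<And>k. k \<ge> N0 \<Longrightarrow> x k \<in> U \<and> (\<forall>j<n. \<bar>\<phi> (x k) j - \<phi> p j\<bar> < \<delta> k)"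
    using rapid unfolding rapidly_converges_def eventually_sequentially by blast
  obtain e where e: "e > 0" "\<And>z. z \<in> Rn n \<Longrightarrow> (\<And>j. j < n \<Longrightarrow> \<bar>z j - \<phi> p j\<bar> < e) \<Longrightarrow> z \<in> \<phi> ` U"
    using chart_contains_box[OF A p] by metis
  obtain N1 where N1: "(1/2) ^ N1 < e / 2"
    using real_arch_pow_inv[of "e / 2" "1/2"] e(1) by auto
  define N where "N = max N0 N1"
  have N: "2 * (1/2) ^ N < e"
  proof -
    have "(1/2::real) ^ N \<le> (1/2) ^ N1" unfolding N_def by (intro power_decreasing) auto
    then show ?thesis using N1 by linarith
  qed
  define G where "G j \<gamma> \<longleftrightarrow> smooth_real UNIV \<gamma> \<and> (\<forall>s\<le>0. \<gamma> s = \<phi> p j) \<and> (\<forall>k\<ge>N. \<gamma> (a k) = \<phi> (x k) j)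
         \<and> (\<forall>s\<ge>a N. \<gamma> s = \<phi> (x N) j) \<and> (\<forall>s. \<bar>\<gamma> s - \<phi> p j\<bar> \<le> 2 * (1/2) ^ N)" for j \<gamma>
  have "\<exists>\<gamma>. G j \<gamma>" if "j < n" for j
  proof -
    have "\<forall>k\<ge>N. \<bar>\<phi> (x k) j - \<phi> p j\<bar> < \<delta> k" using x that by (simp add: N_def)
    then show ?thesis unfolding G_def by (rule interpolation_rateD[OF rate])
  qed
  then obtain \<eta> where G: "\<And>j. j < n \<Longrightarrow> G j (\<eta> j)" by metis
  have \<eta>: "\<And>j. j < n \<Longrightarrow> smooth_real UNIV (\<eta> j)"
    "\<And>j s. j < n \<Longrightarrow> s \<le> 0 \<Longrightarrow> \<eta> j s = \<phi> p j" "\<And>j k. j < n \<Longrightarrow> k \<ge> N \<Longrightarrow> \<eta> j (a k) = \<phi> (x k) j"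
    "\<And>j s. j < n \<Longrightarrow> s \<ge> a N \<Longrightarrow> \<eta> j s = \<phi> (x N) j"
    "\<And>j s. j < n \<Longrightarrow> \<bar>\<eta> j s - \<phi> p j\<bar> \<le> 2 * (1/2) ^ N"
    using G unfolding G_def by simp_all
  define \<gamma> where "\<gamma> s j = (if j < n then \<eta> j s else 0)" for s j
  define c where "c s = inv_into U \<phi> (\<gamma> s)" for s
  have "\<gamma> s \<in> \<phi> ` U" for s
  proof (rule e(2))
    show "\<gamma> s \<in> Rn n" by (simp add: \<gamma>_def Rn_def)
    show "\<bar>\<gamma> s j - \<phi> p j\<bar> < e" if "j < n" for j
      using \<eta>(5)[OF that, of s] N that by (simp add: \<gamma>_def)
  qed
  moreover have "smooth_real UNIV (\<lambda>s. \<gamma> s j)" if "j < n" for j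
    using \<eta>(1)[OF that] that by (simp add: \<gamma>_def)
  ultimately have "smooth_curve X A c" unfolding c_def[abs_def] by (intro chart_curve_smooth[OF A])
  moreover have c_eq: "c s = q" if "q \<in> U" "\<And>j. j < n \<Longrightarrow> \<eta> j s = \<phi> q j" for s q
  proof -
    have "\<gamma> s = \<phi> q" using that chart_coordinate_eq_0[OF A that(1)] by (auto simp: \<gamma>_def)
    then show ?thesis using that(1) chart_on_inj[OF atlas_chart[OF A]] by (simp add: c_def)
  qed
  moreover have "c s = p" if "s \<le> 0" for s using \<eta>(2) that p by (intro c_eq) auto
  moreover have "c (a k) = x k" if "k \<ge> N" for k
    using \<eta>(3) that x[of k] by (intro c_eq) (auto simp: N_def)
  moreover have "c s = x N" if "s \<ge> a N" for s
    using \<eta>(4) that x[of N] by (intro c_eq) (auto simp: N_def)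
  ultimately show ?thesis by blast
qed

text \<open>Interpolation in a chart covers the tail. The finitely many earlier members are reached
  by descending induction on \<open>N\<close>, each time appending a path from
  \<open>x (Suc N)\<close> to \<open>x N\<close>; this is where connectedness enters.\<close>

lemma smooth_curve_through_rapid_sequence:
  assumes conn: "connected_space X"
    and dec: "\<And>k. a (Suc k) < a k" and pos: "\<And>k. 0 < a k" and rate: "interpolation_rate a \<delta>"
    and x: "\<And>k. x k \<in> topspace X" and rapid: "rapidly_converges \<delta> x p"
  shows "\<exists>c. smooth_curve X A c \<and> c 0 = p \<and> (\<forall>k. c (a k) = x k)"
proof -
  define P where "P N \<longleftrightarrow>
    (\<exists>c. smooth_curve X A c \<and> c 0 = p \<and> (\<forall>k\<ge>N. c (a k) = x k) \<and> (\<forall>s\<ge>a N. c s = x N))" for N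
  have a_anti: "a k \<le> a j" if "j \<le> k" for j k
    using that dec by (meson lift_Suc_antimono_le less_imp_le)
  obtain N where "P N"
    using smooth_curve_through_rapid_tail[OF rate rapid]
    unfolding P_def by auto
  moreover have "P N" if PN: "P (Suc N)" for N
  proof -
    obtain c1 where c1: "smooth_curve X A c1" "c1 0 = p" "\<And>k. k \<ge> Suc N \<Longrightarrow> c1 (a k) = x k"
        "\<And>s. s \<ge> a (Suc N) \<Longrightarrow> c1 s = x (Suc N)"
      using PN unfolding P_def by blast
    \<comment> \<open>These cut the interval into thirds: both curves rest at
      \<open>x (Suc N)\<close> on \<open>(a (Suc N), r)\<close>, which contains
      \<open>m\<close>.\<close>
    define m r where "m = (2 * a (Suc N) + a N) / 3" and "r = (a (Suc N) + 2 * a N) / 3"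
    have m: "a (Suc N) < m" "m < r" "r < a N" using dec[of N] by (auto simp: m_def r_def)
    obtain c2 where c2: "smooth_curve X A c2" "\<And>s. s \<le> r \<Longrightarrow> c2 s = x (Suc N)" "\<And>s. s \<ge> a N \<Longrightarrow> c2 s = x N"
      using connected_smoothly_joined[OF conn x x] m(3) unfolding smoothly_joined_def by metis
    define c where "c s = (if s \<le> m then c1 s else c2 s)" for s
    have "smooth_curve X A c"
      unfolding c_def[abs_def]
      by (rule smooth_curve_glue[OF atlas_open c1(1) c2(1) m(1,2)]) (use c1 c2 in auto)
    moreover have "c 0 = p" using m(1) pos[of "Suc N"] c1(2) by (simp add: c_def)
    moreover have cN: "c s = x N" if "s \<ge> a N" for s using that m c2(3) by (simp add: c_def)
    moreover have "c (a k) = x k" if "k \<ge> N" for k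
    proof (cases "k = N")
      case False
      then have "k \<ge> Suc N" using that by simp
      then show ?thesis using a_anti[of "Suc N" k] m(1) c1(3) by (simp add: c_def)
    qed (simp add: cN)
    ultimately show ?thesis unfolding P_def by blast
  qed
  ultimately have "P 0" by (metis inc_induct le0)
  then show ?thesis unfolding P_def by auto
qed

end

section \<open>Functions on products\<close>

text \<open>A countable substitute for transfinite descent. Each step goes below the midpoint
  between the current value and the infimum \<open>I\<close> of the reachable values. A further step
  \<open>q'\<close> from the limit \<open>q\<close> is reachable from every
  \<open>\<sigma> k\<close>, so \<open>m (\<sigma> k) - m q'\<close> is at least halved each time,
  which forces \<open>m q \<le> m q'\<close> and contradicts the choice of
  \<open>q'\<close>.\<close>

lemma greedy_descent:
  fixes m :: "'s \<Rightarrow> real"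
  assumes start: "Q p0" and nonneg: "\<And>p. Q p \<Longrightarrow> 0 \<le> m p"
    and trans: "\<And>p q r. R p q \<Longrightarrow> R q r \<Longrightarrow> R p r"
    and step: "\<And>p. Q p \<Longrightarrow> 0 < m p \<Longrightarrow> \<exists>q. Q q \<and> R p q \<and> m q < m p"
    and limit: "\<And>\<sigma>. (\<And>k. Q (\<sigma> k) \<and> R (\<sigma> k) (\<sigma> (Suc k)) \<and> m (\<sigma> (Suc k)) < m (\<sigma> k))
      \<Longrightarrow> \<exists>q. Q q \<and> (\<forall>k. R (\<sigma> k) q \<and> m q \<le> m (\<sigma> k))"
  shows "\<exists>p. Q p \<and> m p = 0"
proof (rule ccontr)
  assume "\<not> ?thesis"
  then have pos: "0 < m p" if "Q p" for p using nonneg[OF that] that by fastforce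
  define I where "I p = Inf (m ` {q. Q q \<and> R p q})" for p
  have bdd: "bdd_below (m ` {q. Q q \<and> R p q})" for p
    using nonneg by (auto intro!: bdd_belowI[of _ 0])
  have I_le: "I p \<le> m q" if "Q q" "R p q" for p q
    unfolding I_def using that by (intro cInf_lower[OF _ bdd]) auto
  have ex: "\<exists>q. Q q \<and> R p q \<and> m q < m p \<and> m q < (m p + I p) / 2" if p: "Q p" for p
  proof -
    obtain q where q: "Q q" "R p q" "m q < m p" using step[OF p pos[OF p]] by blast
    then have "I p < (m p + I p) / 2" "(m p + I p) / 2 < m p" using I_le[OF q(1,2)] by auto
    moreover have "m ` {q. Q q \<and> R p q} \<noteq> {}" using q by auto
    ultimately obtain v where "v \<in> m ` {q. Q q \<and> R p q}" "v < (m p + I p) / 2"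
      using cInf_lessD[of "m ` {q. Q q \<and> R p q}" "(m p + I p) / 2"] by (auto simp: I_def[symmetric])
    with \<open>(m p + I p) / 2 < m p\<close> show ?thesis by auto
  qed
  have "\<exists>\<sigma>. \<forall>k::nat. Q (\<sigma> k) \<and> (R (\<sigma> k) (\<sigma> (Suc k)) \<and> m (\<sigma> (Suc k)) < m (\<sigma> k)
      \<and> m (\<sigma> (Suc k)) < (m (\<sigma> k) + I (\<sigma> k)) / 2)"
    by (rule dependent_nat_choice) (use start in blast, rule ex)
  then obtain \<sigma> where \<sigma>: "\<And>k. Q (\<sigma> k)" "\<And>k. R (\<sigma> k) (\<sigma> (Suc k))" "\<And>k. m (\<sigma> (Suc k)) < m (\<sigma> k)"
      "\<And>k. m (\<sigma> (Suc k)) < (m (\<sigma> k) + I (\<sigma> k)) / 2"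
    by blast
  have "\<exists>q. Q q \<and> (\<forall>k. R (\<sigma> k) q \<and> m q \<le> m (\<sigma> k))" using \<sigma> by (intro limit) blast
  then obtain q where q: "Q q" "\<And>k. R (\<sigma> k) q" "\<And>k. m q \<le> m (\<sigma> k)" by blast
  obtain q' where q': "Q q'" "R q q'" "m q' < m q" using step[OF q(1) pos[OF q(1)]] by blast
  have half: "m (\<sigma> (Suc k)) - m q' \<le> (m (\<sigma> k) - m q') / 2" for k
    using \<sigma>(4)[of k] I_le[OF q'(1) trans[OF q(2)[of k] q'(2)]] by (simp add: field_simps)
  have geo: "m (\<sigma> k) - m q' \<le> (m (\<sigma> 0) - m q') * (1/2) ^ k" for k
  proof (induction k)
    case (Suc k)
    then show ?case using half[of k] by simp
  qed simp
  have "m q - m q' \<le> (m (\<sigma> 0) - m q') * (1/2) ^ k" for k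
    using q(3)[of k] geo[of k] by linarith
  moreover have "(\<lambda>k. (m (\<sigma> 0) - m q') * (1/2) ^ k) \<longlonglongrightarrow> (m (\<sigma> 0) - m q') * 0"
    by (intro tendsto_mult tendsto_const LIMSEQ_realpow_zero) auto
  ultimately have "m q - m q' \<le> (m (\<sigma> 0) - m q') * 0"
    by (intro LIMSEQ_le_const[of "\<lambda>k. (m (\<sigma> 0) - m q') * (1/2) ^ k"]) auto
  then show False using q'(3) by simp
qed

text \<open>Sweep the index set, ordered by \<open>r\<close>, from right to left, replacing the part already passed by
  a countable set. Moving left from \<open>s\<close> costs nothing because \<open>{r < u} \<rightarrow> {r < s}\<close> as \<open>u\<close> increases
  to \<open>s\<close>; at the limit \<open>l\<close> of a decreasing sequence of positions only the index at \<open>l\<close> is added.\<close>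

lemma countable_subset_same_value:
  fixes F :: "'i set \<Rightarrow> real" and r :: "'i \<Rightarrow> real"
  assumes inj: "inj_on r T" and r: "\<And>t. t \<in> T \<Longrightarrow> 0 < r t \<and> r t < 1"
    and stat: "\<And>B B'. (\<And>t. t \<in> T \<Longrightarrow> \<forall>\<^sub>F k in sequentially. t \<in> B k \<longleftrightarrow> t \<in> B')
      \<Longrightarrow> \<forall>\<^sub>F k in sequentially. F (B k) = F B'"
  shows "\<exists>C\<subseteq>T. countable C \<and> F C = F T"
proof -
  \<comment> \<open>Constant sequences in \<open>stat\<close> show that \<open>F\<close> sees only
    the part of its argument in \<open>T\<close>.\<close>
  have F_cong: "F B = F B'" if "\<And>t. t \<in> T \<Longrightarrow> t \<in> B \<longleftrightarrow> t \<in> B'" for B B'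
  proof -
    have "\<forall>\<^sub>F k in sequentially. F B = F B'" by (rule stat[of "\<lambda>_. B"]) (simp add: that)
    then show ?thesis by simp
  qed
  \<comment> \<open>In a state \<open>(s, C)\<close> the indices at or to the right of
    \<open>s\<close> have been thinned out to \<open>C\<close> without changing the value.\<close>
  define Q where "Q = (\<lambda>(s::real, C). 0 \<le> s \<and> countable C \<and> C \<subseteq> {t \<in> T. r t \<ge> s} \<and> F ({t. r t < s} \<union> C) = F T)"
  \<comment> \<open>Later states add to \<open>C\<close> only to the left of \<open>s\<close>; this
    coherence is what makes the sets converge pointwise.\<close>
  define R where "R = (\<lambda>(s::real, C) (s', C'). s' \<le> s \<and> C' \<inter> {t. r t \<ge> s} = C)"
  have "\<exists>p. Q p \<and> fst p = 0"
  proof (rule greedy_descent[where R=R])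
    show "Q (1, {})" using r by (auto simp: Q_def intro!: F_cong)
    show "0 \<le> fst p" if "Q p" for p using that by (auto simp: Q_def)
    show "R p q" if "R p p'" "R p' q" for p p' q
      using that unfolding R_def by (force split: prod.splits)
  next
    fix p assume p: "Q p" "0 < fst p"
    obtain s C where [simp]: "p = (s, C)" by (cases p)
    have s: "s > 0" "countable C" "C \<subseteq> {t \<in> T. r t \<ge> s}" "F ({t. r t < s} \<union> C) = F T"
      using p by (auto simp: Q_def)
    define u where "u k = s - s / real (Suc (Suc k))" for k
    have u: "u k < s" "0 \<le> u k" for k using s(1) by (auto simp: u_def field_simps)
    have "(\<lambda>k. s / real (Suc (Suc k))) \<longlonglongrightarrow> 0"
      using LIMSEQ_Suc[OF LIMSEQ_Suc[OF lim_const_over_n[of s]]] by simp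
    then have u_lim: "u \<longlonglongrightarrow> s"
      using tendsto_diff[OF tendsto_const[of s]] by (fastforce simp: u_def[abs_def])
    have "\<forall>\<^sub>F k in sequentially. F ({t. r t < u k} \<union> C) = F ({t. r t < s} \<union> C)"
    proof (rule stat)
      fix t
      show "\<forall>\<^sub>F k in sequentially. t \<in> {t. r t < u k} \<union> C \<longleftrightarrow> t \<in> {t. r t < s} \<union> C"
      proof (cases "r t < s")
        case True
        then show ?thesis using order_tendstoD(1)[OF u_lim True] by (auto elim!: eventually_mono)
      next
        case False
        then have "\<not> r t < u k" for k using u(1)[of k] by linarith
        then show ?thesis using False by simp
      qed
    qed
    then obtain k where k: "F ({t. r t < u k} \<union> C) = F ({t. r t < s} \<union> C)"
      by (auto simp: eventually_sequentially)
    have "Q (u k, C)" using s k u[of k] by (fastforce simp: Q_def)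
    moreover have "R p (u k, C)" using s(3) u(1)[of k] by (auto simp: R_def)
    ultimately show "\<exists>q. Q q \<and> R p q \<and> fst q < fst p" using u(1)[of k] by force
  next
    fix \<sigma> :: "nat \<Rightarrow> real \<times> 'i set"
    assume \<sigma>: "\<And>k. Q (\<sigma> k) \<and> R (\<sigma> k) (\<sigma> (Suc k)) \<and> fst (\<sigma> (Suc k)) < fst (\<sigma> k)"
    define s C where "s k = fst (\<sigma> k)" and "C k = snd (\<sigma> k)" for k
    have Qk: "0 \<le> s k" "countable (C k)" "C k \<subseteq> {t \<in> T. r t \<ge> s k}" "F ({t. r t < s k} \<union> C k) = F T" for k
      using \<sigma>[of k] by (auto simp: Q_def s_def C_def split: prod.splits)
    have Rk: "C (Suc k) \<inter> {t. r t \<ge> s k} = C k" for k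
      using \<sigma>[of k] by (auto simp: R_def s_def C_def split: prod.splits)
    have s_dec: "s (Suc k) < s k" for k using \<sigma>[of k] by (simp add: s_def)
    have s_anti: "s j \<le> s k" if "k \<le> j" for j k
      using that s_dec by (meson lift_Suc_antimono_le less_imp_le)
    have C_trunc: "C j \<inter> {t. r t \<ge> s k} = C k" if "k \<le> j" for j k
      using that
    proof (induction j rule: dec_induct)
      case base
      then show ?case using Qk(3)[of k] by auto
    next
      case (step j)
      have "C (Suc j) \<inter> {t. r t \<ge> s k} = (C (Suc j) \<inter> {t. r t \<ge> s j}) \<inter> {t. r t \<ge> s k}"
        using s_anti[OF step(1)] by auto
      then show ?case using Rk[of j] step by simp
    qed
    have C_mono: "C k \<subseteq> C j" if "k \<le> j" for j k using C_trunc[OF that] by auto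
    have "decseq s" using s_anti by (auto simp: decseq_def)
    then obtain l where l: "s \<longlonglongrightarrow> l" "\<And>k. l \<le> s k"
      using decseq_convergent[of s 0] Qk(1) by auto
    have l_less: "l < s k" for k using l(2)[of "Suc k"] s_dec[of k] by linarith
    have "0 \<le> l" using LIMSEQ_le_const[OF l(1)] Qk(1) by auto
    \<comment> \<open>An index at \<open>l\<close> lies left of every \<open>s k\<close> but not
      left of \<open>l\<close>, so it has to be added; injectivity of \<open>r\<close> leaves at
      most one.\<close>
    define D where "D = (\<Union>k. C k) \<union> {t \<in> T. r t = l}"
    have "countable {t \<in> T. r t = l}"
    proof (rule countable_image_inj_on)
      show "countable (r ` {t \<in> T. r t = l})" by (rule countable_subset[of _ "{l}"]) auto
      show "inj_on r {t \<in> T. r t = l}" using inj by (rule inj_on_subset) auto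
    qed
    then have "countable D" using Qk(2) by (simp add: D_def)
    have D_sub: "D \<subseteq> {t \<in> T. r t \<ge> l}"
    proof
      fix t assume "t \<in> D"
      then consider k where "t \<in> C k" | "t \<in> T" "r t = l" by (auto simp: D_def)
      then show "t \<in> {t \<in> T. r t \<ge> l}"
      proof cases
        case 1
        then show ?thesis using Qk(3)[of k] l(2)[of k] by auto
      qed auto
    qed
    have "\<forall>\<^sub>F k in sequentially. F ({t. r t < s k} \<union> C k) = F ({t. r t < l} \<union> D)"
    proof (rule stat)
      fix t assume t: "t \<in> T"
      show "\<forall>\<^sub>F k in sequentially. t \<in> {t. r t < s k} \<union> C k \<longleftrightarrow> t \<in> {t. r t < l} \<union> D"
      proof (cases "r t \<le> l")
        case True
        then have "r t < s k" for k using l_less[of k] by linarith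
        moreover have "t \<in> {t. r t < l} \<union> D" using True t by (auto simp: D_def)
        ultimately show ?thesis by simp
      next
        case False
        then obtain K where K: "s K \<le> r t"
          using order_tendstoD(2)[OF l(1), of "r t"] by (auto simp: eventually_sequentially intro: less_imp_le)
        have "t \<in> {t. r t < s k} \<union> C k \<longleftrightarrow> t \<in> {t. r t < l} \<union> D" if "k \<ge> K" for k
        proof -
          have "t \<in> C k" if "t \<in> C j" for j
          proof (cases "j \<le> k")
            case True
            then show ?thesis using C_mono that by blast
          next
            case False
            then have "C j \<inter> {t. r t \<ge> s k} = C k" by (intro C_trunc) simp
            moreover have "s k \<le> r t" using K s_anti[OF \<open>k \<ge> K\<close>] by linarith
            ultimately show ?thesis using that by blast
          qed
          moreover have "\<not> r t < s k" using K s_anti[OF that] by linarith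
          ultimately show ?thesis using False by (auto simp: D_def)
        qed
        then show ?thesis by (auto simp: eventually_sequentially)
      qed
    qed
    then have "F ({t. r t < l} \<union> D) = F T" using Qk(4) by (auto simp: eventually_sequentially)
    then have "Q (l, D)" using \<open>0 \<le> l\<close> \<open>countable D\<close> D_sub by (simp add: Q_def)
    moreover have "R (\<sigma> k) (l, D)" for k
    proof -
      have "D \<inter> {t. r t \<ge> s k} = C k"
      proof
        show "C k \<subseteq> D \<inter> {t. r t \<ge> s k}" using Qk(3)[of k] by (auto simp: D_def)
        show "D \<inter> {t. r t \<ge> s k} \<subseteq> C k"
        proof
          fix t assume t: "t \<in> D \<inter> {t. r t \<ge> s k}"
          then obtain j where "t \<in> C j" using l_less[of k] by (auto simp: D_def)
          moreover have "C j \<subseteq> C k \<or> C j \<inter> {t. r t \<ge> s k} = C k"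
            using C_trunc[of k j] C_mono[of j k] by linarith
          ultimately show "t \<in> C k" using t by blast
        qed
      qed
      then show ?thesis using l(2)[of k] by (simp add: R_def s_def C_def case_prod_beta)
    qed
    ultimately show "\<exists>q. Q q \<and> (\<forall>k. R (\<sigma> k) q \<and> fst q \<le> fst (\<sigma> k))"
      using l(2) by (intro exI[of _ "(l, D)"]) (auto simp: s_def)
  qed
  then obtain C where C: "countable C" "C \<subseteq> T" "F ({t. r t < 0} \<union> C) = F T"
    by (auto simp: Q_def)
  moreover have "F ({t. r t < 0} \<union> C) = F C" using r by (intro F_cong) fastforce
  ultimately show ?thesis by auto
qed

context
  fixes M :: "'i \<Rightarrow> 'a topology"
    and A :: "'i \<Rightarrow> (('a \<Rightarrow> nat \<Rightarrow> real) \<times> 'a set) set"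
    and dim :: "'i \<Rightarrow> nat" and T :: "'i set" and f :: "('i \<Rightarrow> 'a) \<Rightarrow> real"
  assumes manifolds: "\<And>t. t \<in> T \<Longrightarrow> smooth_manifold (M t) (dim t) (A t)"
    and connected: "\<And>t. t \<in> T \<Longrightarrow> connected_space (M t)"
    and smooth: "prod_smooth M A T f"
begin

abbreviation (input) "pts \<equiv> topspace (product_topology M T)"

section \<open>Curves in the product and the behaviour of \<open>f\<close> along them\<close>

text \<open>Times and rate are common to all factors, so curves chosen independently in each factor
  combine to a curve in the product.\<close>

lemma prod_curve_through_rapid_sequence:
  assumes dec: "\<And>k. a (Suc k) < a k" and pos: "\<And>k. 0 < a k" and rate: "interpolation_rate a \<delta>"
    and x: "\<And>k. x k \<in> pts" and p: "p \<in> pts"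
    and rapid: "\<And>t. t \<in> T \<Longrightarrow> rapidly_converges (dim t) (A t) \<delta> (\<lambda>k. x k t) (p t)"
  shows "\<exists>c. prod_curve M A T c \<and> c 0 = p \<and> (\<forall>k. c (a k) = x k)"
proof -
  have "\<exists>c. smooth_curve (M t) (A t) c \<and> c 0 = p t \<and> (\<forall>k. c (a k) = x k t)" if "t \<in> T" for t
    by (rule smooth_curve_through_rapid_sequence[OF manifolds[OF that] connected[OF that] dec pos rate _ rapid[OF that]])
       (use x that in auto)
  then obtain c where c: "\<And>t. t \<in> T \<Longrightarrow> smooth_curve (M t) (A t) (c t)" "\<And>t. t \<in> T \<Longrightarrow> c t 0 = p t"
      "\<And>t k. t \<in> T \<Longrightarrow> c t (a k) = x k t"
    by metis
  define c' where "c' s = (\<lambda>t\<in>T. c t s)" for s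
  have "c' s \<in> pts" for s
    using smooth_curve_in_topspace[OF c(1)] by (auto simp: c'_def)
  moreover have "smooth_curve (M t) (A t) (\<lambda>s. c' s t)" if "t \<in> T" for t
    using c(1)[OF that] that by (simp add: c'_def)
  ultimately have "prod_curve M A T c'" by (simp add: prod_curve_def)
  moreover have "c' s = q" if "q \<in> pts" "\<And>t. t \<in> T \<Longrightarrow> c t s = q t" for s q
    using that by (auto simp: c'_def fun_eq_iff PiE_iff extensional_def)
  then have "c' 0 = p" "\<And>k. c' (a k) = x k" using c(2,3) x p by blast+
  ultimately show ?thesis by blast
qed

lemma differentiable_along_prod_curve:
  "prod_curve M A T c \<Longrightarrow> (f \<circ> c) differentiable (at s)"
proof -
  assume "prod_curve M A T c"
  then have "smooth_real UNIV (f \<circ> c)" using smooth by (simp add: prod_smooth_def)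
  then have "(deriv ^^ 0) (f \<circ> c) differentiable (at s)" unfolding smooth_real_def by blast
  then show ?thesis by simp
qed

text \<open>If every coordinate is eventually constant, a smooth curve can run through the sequence at
  arbitrarily small times, so a nonzero difference of values would contradict differentiability.\<close>

lemma eventually_eq_if_coordinates_stationary:
  assumes x: "\<And>k. x k \<in> pts" and p: "p \<in> pts"
    and stat: "\<And>t. t \<in> T \<Longrightarrow> \<forall>\<^sub>F k in sequentially. x k t = p t"
  shows "\<forall>\<^sub>F k in sequentially. f (x k) = f p"
proof (rule ccontr)
  assume "\<not> ?thesis"
  then obtain r :: "nat \<Rightarrow> nat" where r: "strict_mono r" "\<And>k. f (x (r k)) \<noteq> f p"
    using not_eventually_sequentiallyD by blast
  define b where "b k = \<bar>f (x (r k)) - f p\<bar>" for k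
  have b: "b k > 0" for k using r(2) by (simp add: b_def)
  \<comment> \<open>The bound by \<open>b k / real (Suc k)\<close> makes the difference quotient at
    \<open>a k\<close> at least \<open>k + 1\<close> in absolute value; the bound by
    \<open>1 / real (Suc k)\<close> sends the times to \<open>0\<close>.\<close>
  have "\<exists>a. \<forall>k::nat. (0 < a k \<and> a k \<le> b k / real (Suc k) \<and> a k \<le> 1 / real (Suc k)) \<and> a (Suc k) < a k"
  proof (rule dependent_nat_choice)
    show "\<exists>v. 0 < v \<and> v \<le> b 0 / real (Suc 0) \<and> v \<le> 1 / real (Suc 0)"
      using b[of 0] by (intro exI[of _ "min (b 0) 1"]) auto
    fix v k assume "0 < v \<and> v \<le> b k / real (Suc k) \<and> v \<le> 1 / real (Suc k)"
    then show "\<exists>w. (0 < w \<and> w \<le> b (Suc k) / real (Suc (Suc k)) \<and> w \<le> 1 / real (Suc (Suc k))) \<and> w < v"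
      using b[of "Suc k"]
      by (intro exI[of _ "min (v / 2) (min (b (Suc k) / real (Suc (Suc k))) (1 / real (Suc (Suc k))))"])
         (auto simp: min_less_iff_disj min_le_iff_disj)
  qed
  then obtain a where a: "\<And>k. 0 < a k" "\<And>k. a k \<le> b k / real (Suc k)" "\<And>k. a k \<le> 1 / real (Suc k)"
      "\<And>k. a (Suc k) < a k"
    by blast
  obtain \<delta> where \<delta>: "interpolation_rate a \<delta>" using interpolation_rate_exists[of a] a(1,4) by blast
  then have \<delta>_pos: "\<delta> k > 0" for k by (simp add: interpolation_rate_def)
  \<comment> \<open>Eventually constant coordinates are rapid for every positive rate, so choosing
    the times by the values of \<open>f\<close> was legitimate.\<close>
  have "rapidly_converges (dim t) (A t) \<delta> (\<lambda>k. x (r k) t) (p t)" if "t \<in> T" for t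
    using p that eventually_subseq[OF r(1) stat[OF that]]
    by (intro rapidly_converges_eventually_const[OF manifolds[OF that]] \<delta>_pos) auto
  then obtain c where c: "prod_curve M A T c" "c 0 = p" "\<And>k. c (a k) = x (r k)"
    using prod_curve_through_rapid_sequence[where a=a and \<delta>=\<delta> and x="\<lambda>k. x (r k)" and p=p, OF a(4,1) \<delta> x p] by blast
  obtain D where "((f \<circ> c) has_real_derivative D) (at 0)"
    using differentiable_along_prod_curve[OF c(1)] real_differentiable_def by blast
  then have lim: "((\<lambda>h. (f (c h) - f (c 0)) / h) \<longlongrightarrow> D) (at 0)" by (simp add: DERIV_def)
  have "a \<longlonglongrightarrow> 0"
    by (rule tendsto_sandwich[OF _ _ tendsto_const lim_1_over_n[THEN LIMSEQ_Suc]])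
       (use a(1,3) in \<open>auto intro!: always_eventually less_imp_le\<close>)
  then have "filterlim a (at 0) sequentially"
    using a(1) by (auto simp: filterlim_at less_imp_neq[symmetric])
  from filterlim_compose[OF lim this]
  have "(\<lambda>k. (f (x (r k)) - f p) / a k) \<longlonglongrightarrow> D" by (simp add: c)
  then have "Bseq (\<lambda>k. (f (x (r k)) - f p) / a k)" by (intro convergent_imp_Bseq convergentI)
  then obtain K where K: "\<And>k. norm ((f (x (r k)) - f p) / a k) \<le> K" unfolding Bseq_def by blast
  have "real (Suc k) \<le> K" for k
  proof -
    have "real (Suc k) \<le> b k / a k" using a(1,2)[of k] by (simp add: field_simps)
    also have "\<dots> = norm ((f (x (r k)) - f p) / a k)" using a(1)[of k] by (simp add: b_def)
    finally show ?thesis using K[of k] by linarith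
  qed
  moreover obtain k where "K < real k" using reals_Archimedean2 by blast
  ultimately show False by (metis less_le_not_le lessI of_nat_less_iff order_trans)
qed

text \<open>The times \<open>(1/2) ^ k\<close> are fixed once, so \<open>\<delta>\<close> serves all
  sequences and limits. The limit comes from continuity of \<open>f\<close> at time \<open>0\<close>
  along a curve through the sequence.\<close>

lemma tendsto_if_coordinates_rapidly_converge:
  "\<exists>\<delta>. (\<forall>k. \<delta> k > 0) \<and> (\<forall>x p. (\<forall>k. x k \<in> pts) \<longrightarrow> p \<in> pts \<longrightarrow>
      (\<forall>t\<in>T. rapidly_converges (dim t) (A t) \<delta> (\<lambda>k. x k t) (p t)) \<longrightarrow> (\<lambda>k. f (x k)) \<longlonglongrightarrow> f p)"
proof -
  define a :: "nat \<Rightarrow> real" where "a k = (1/2) ^ k" for k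
  have a: "a (Suc k) < a k" "0 < a k" for k by (auto simp: a_def)
  obtain \<delta> where \<delta>: "interpolation_rate a \<delta>" using interpolation_rate_exists[of a] a by blast
  have "(\<lambda>k. f (x k)) \<longlonglongrightarrow> f p" if x: "\<forall>k. x k \<in> pts" and p: "p \<in> pts"
    and rapid: "\<forall>t\<in>T. rapidly_converges (dim t) (A t) \<delta> (\<lambda>k. x k t) (p t)" for x p
  proof -
    obtain c where c: "prod_curve M A T c" "c 0 = p" "\<And>k. c (a k) = x k"
      using prod_curve_through_rapid_sequence[where a=a and \<delta>=\<delta> and x=x and p=p, OF a \<delta> _ p] x rapid by blast
    have "isCont (f \<circ> c) 0"
      using differentiable_along_prod_curve[OF c(1)] differentiable_imp_continuous_within by blast
    moreover have "a \<longlonglongrightarrow> 0" unfolding a_def by (rule LIMSEQ_realpow_zero) auto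
    ultimately have "(\<lambda>k. (f \<circ> c) (a k)) \<longlonglongrightarrow> (f \<circ> c) 0" by (rule isCont_tendsto_compose)
    then show ?thesis by (simp add: c)
  qed
  then show ?thesis using \<delta> unfolding interpolation_rate_def by blast
qed

definition mix :: "('i \<Rightarrow> 'a) \<Rightarrow> ('i \<Rightarrow> 'a) \<Rightarrow> 'i set \<Rightarrow> 'i \<Rightarrow> 'a" where
  "mix y x B = (\<lambda>t\<in>T. if t \<in> B then y t else x t)"

lemma mix_in_pts: "y \<in> pts \<Longrightarrow> x \<in> pts \<Longrightarrow> mix y x B \<in> pts"
  by (auto simp: mix_def PiE_iff)

text \<open>Otherwise one builds points \<open>w k\<close> with \<open>f (w k) \<noteq> f q\<close>
  that differ from \<open>q\<close> on pairwise disjoint countable sets. Each coordinate then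
  differs from that of \<open>q\<close> at most once, against
  \<open>eventually_eq_if_coordinates_stationary\<close>.\<close>

lemma countable_set_determines_value:
  assumes card: "T \<lesssim> (UNIV :: real set)" and q: "q \<in> pts"
  shows "\<exists>D\<subseteq>T. countable D \<and> (\<forall>y\<in>pts. (\<forall>t\<in>D. y t = q t) \<longrightarrow> f y = f q)"
proof (rule ccontr)
  assume neg: "\<not> ?thesis"
  have "T \<lesssim> {0<..<1::real}"
    using card open_interval_eqpoll_reals[of 0 1] eqpoll_sym lepoll_trans1 lepoll_trans2 by fastforce
  then obtain r :: "'i \<Rightarrow> real" where r: "inj_on r T" "\<And>t. t \<in> T \<Longrightarrow> 0 < r t \<and> r t < 1"
    unfolding lepoll_def by (auto simp: image_subset_iff)
  \<comment> \<open>Each value of \<open>f\<close> is also attained at a point that differs from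
    \<open>q\<close> only on a countable set.\<close>
  have red: "\<exists>C. countable C \<and> f (mix y q C) = f y" if y: "y \<in> pts" for y
  proof -
    have "\<exists>C\<subseteq>T. countable C \<and> f (mix y q C) = f (mix y q T)"
    proof (rule countable_subset_same_value[OF r, where F="\<lambda>B. f (mix y q B)"])
      fix B B' assume B: "\<And>t. t \<in> T \<Longrightarrow> \<forall>\<^sub>F k in sequentially. (t \<in> B k) = (t \<in> B')"
      show "\<forall>\<^sub>F k in sequentially. f (mix y q (B k)) = f (mix y q B')"
      proof (rule eventually_eq_if_coordinates_stationary)
        show "\<forall>\<^sub>F k in sequentially. mix y q (B k) t = mix y q B' t" if "t \<in> T" for t
          using B[OF that] by eventually_elim (simp add: mix_def)
      qed (intro mix_in_pts y q)+
    qed auto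
    moreover have "mix y q T = y" using y by (auto simp: mix_def fun_eq_iff PiE_iff extensional_def)
    ultimately show ?thesis by auto
  qed
  have ex: "\<exists>w C. countable C \<and> w \<in> pts \<and> (\<forall>t\<in>D. w t = q t) \<and> (\<forall>t\<in>T - C. w t = q t) \<and> f w \<noteq> f q"
    if D: "D \<subseteq> T" "countable D" for D
  proof -
    obtain y where y: "y \<in> pts" "\<forall>t\<in>D. y t = q t" "f y \<noteq> f q" using neg D by blast
    obtain C where C: "countable C" "f (mix y q C) = f y" using red[OF y(1)] by blast
    have "\<forall>t\<in>D. mix y q C t = q t" "\<forall>t\<in>T - C. mix y q C t = q t"
      using y(2) D(1) by (auto simp: mix_def)
    then show ?thesis using C y(3) mix_in_pts[OF y(1) q] by metis
  qed
  define G where "G D w C \<longleftrightarrow> countable C \<and> w \<in> pts \<and> (\<forall>t\<in>D. w t = q t) \<and> (\<forall>t\<in>T - C. w t = q t) \<and> f w \<noteq> f q"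
    for D w C
  \<comment> \<open>\<open>D\<close> accumulates the exceptional sets used so far, and the next
    point has to agree with \<open>q\<close> on it.\<close>
  have "\<exists>\<sigma>. \<forall>k::nat. (case \<sigma> k of (D, w, C) \<Rightarrow> D \<subseteq> T \<and> countable D \<and> G D w C)
      \<and> fst (\<sigma> (Suc k)) = fst (\<sigma> k) \<union> (snd (snd (\<sigma> k)) \<inter> T)"
  proof (rule dependent_nat_choice)
    show "\<exists>p. case p of (D, w, C) \<Rightarrow> D \<subseteq> T \<and> countable D \<and> G D w C"
      using ex[of "{}"] by (auto simp: G_def)
    fix p :: "'i set \<times> ('i \<Rightarrow> 'a) \<times> 'i set"
    assume p: "case p of (D, w, C) \<Rightarrow> D \<subseteq> T \<and> countable D \<and> G D w C"
    obtain D w C where [simp]: "p = (D, w, C)" by (cases p)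
    have "D \<union> (C \<inter> T) \<subseteq> T" "countable (D \<union> (C \<inter> T))" using p by (auto simp: G_def)
    from ex[OF this] obtain w' C' where "G (D \<union> (C \<inter> T)) w' C'" unfolding G_def by blast
    then show "\<exists>p'. (case p' of (D, w, C) \<Rightarrow> D \<subseteq> T \<and> countable D \<and> G D w C)
        \<and> fst p' = fst p \<union> (snd (snd p) \<inter> T)"
      using \<open>D \<union> (C \<inter> T) \<subseteq> T\<close> \<open>countable (D \<union> (C \<inter> T))\<close>
      by (intro exI[of _ "(D \<union> (C \<inter> T), w', C')"]) auto
  qed
  then obtain \<sigma> where \<sigma>: "\<forall>k. (case \<sigma> k of (D, w, C) \<Rightarrow> D \<subseteq> T \<and> countable D \<and> G D w C)
      \<and> fst (\<sigma> (Suc k)) = fst (\<sigma> k) \<union> (snd (snd (\<sigma> k)) \<inter> T)" ..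
  define D w C where "D k = fst (\<sigma> k)" and "w k = fst (snd (\<sigma> k))" and "C k = snd (snd (\<sigma> k))" for k :: nat
  have G: "G (D k) (w k) (C k)" for k using \<sigma> by (simp add: D_def w_def C_def case_prod_beta)
  have DS: "D (Suc k) = D k \<union> (C k \<inter> T)" for k using \<sigma> by (simp add: D_def C_def)
  have D_mono: "D j \<subseteq> D k" if "j \<le> k" for j k
    by (rule lift_Suc_mono_le[OF _ that]) (use DS in blast)
  have "\<forall>\<^sub>F k in sequentially. f (w k) = f q"
  proof (rule eventually_eq_if_coordinates_stationary)
    show "w k \<in> pts" for k using G[of k] by (simp add: G_def)
    fix t assume t: "t \<in> T"
    show "\<forall>\<^sub>F k in sequentially. w k t = q t"
    proof (cases "\<exists>j. t \<in> C j")
      case True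
      then obtain j where "t \<in> D (Suc j)" using DS t by blast
      then have "w k t = q t" if "k \<ge> Suc j" for k using G[of k] D_mono[OF that] by (auto simp: G_def)
      then show ?thesis unfolding eventually_sequentially by blast
    next
      case False
      then have "w k t = q t" for k using G[of k] t by (auto simp: G_def)
      then show ?thesis by simp
    qed
  qed (rule q)
  then show False using G by (auto simp: G_def eventually_sequentially)
qed

section \<open>A countable determining set of coordinates and continuity\<close>

text \<open>\<open>T0\<close> contains the determining sets of all points given by finitely many
  dense values at indices in \<open>T0\<close> and by \<open>z\<close> elsewhere. Such points
  approximate any \<open>x\<close> on \<open>T0\<close>, and their values of \<open>f\<close> are
  determined on \<open>T0\<close>, so points that agree on \<open>T0\<close> have values that are
  limits of the same sequence.\<close>

lemma countably_many_coordinates_determine: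
  assumes card: "T \<lesssim> (UNIV :: real set)"
  shows "\<exists>T0\<subseteq>T. countable T0 \<and> (\<forall>x\<in>pts. \<forall>y\<in>pts. (\<forall>t\<in>T0. x t = y t) \<longrightarrow> f x = f y)"
proof (cases "pts = {}")
  case False
  then obtain z where z: "z \<in> pts" by blast
  define determining where "determining q D \<longleftrightarrow>
    D \<subseteq> T \<and> countable D \<and> (\<forall>y\<in>pts. (\<forall>t\<in>D. y t = q t) \<longrightarrow> f y = f q)" for q D
  have "\<exists>D. determining q D" if "q \<in> pts" for q
    using countable_set_determines_value[OF card that] unfolding determining_def by blast
  then obtain D where "\<And>q. q \<in> pts \<Longrightarrow> determining q (D q)" by metis
  then have D: "\<And>q. q \<in> pts \<Longrightarrow> D q \<subseteq> T" "\<And>q. q \<in> pts \<Longrightarrow> countable (D q)"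
      "\<And>q y. q \<in> pts \<Longrightarrow> y \<in> pts \<Longrightarrow> (\<And>t. t \<in> D q \<Longrightarrow> y t = q t) \<Longrightarrow> f y = f q"
    unfolding determining_def by blast+
  define dense where "dense t E \<longleftrightarrow>
    countable E \<and> E \<subseteq> topspace (M t) \<and> M t closure_of E = topspace (M t)" for t E
  have "\<exists>E. dense t E" if "t \<in> T" for t
    using second_countable_imp_separable_space[of "M t"] manifolds[OF that]
    unfolding smooth_manifold_def separable_space_def dense_def by blast
  then obtain E where "\<And>t. t \<in> T \<Longrightarrow> dense t (E t)" by metis
  then have E: "\<And>t. t \<in> T \<Longrightarrow> countable (E t)" "\<And>t. t \<in> T \<Longrightarrow> E t \<subseteq> topspace (M t)"
      "\<And>t. t \<in> T \<Longrightarrow> M t closure_of E t = topspace (M t)"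
    unfolding dense_def by blast+
  \<comment> \<open>Finite lists of index-value pairs encode the approximating points, so that a
    countable index set yields countably many.\<close>
  define point where "point l = (\<lambda>t\<in>T. case map_of l t of None \<Rightarrow> z t | Some p \<Rightarrow> p)" for l
  have point_pts: "point l \<in> pts" if "l \<in> lists (Sigma T E)" for l
  proof -
    have "(case map_of l t of None \<Rightarrow> z t | Some p \<Rightarrow> p) \<in> topspace (M t)" if "t \<in> T" for t
    proof (cases "map_of l t")
      case None
      then show ?thesis using z that by (auto simp: PiE_iff)
    next
      case (Some p)
      then have "(t, p) \<in> Sigma T E" using map_of_SomeD[of l t p] \<open>l \<in> lists _\<close> by blast
      then show ?thesis using E(2)[OF that] Some by auto
    qed
    then show ?thesis by (simp add: point_def)
  qed
  \<comment> \<open>One round of closing off: the determining sets of all points already encoded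
    over \<open>S\<close> are added.\<close>
  define grow where "grow S = S \<union> (\<Union>l\<in>lists (Sigma S E). D (point l))" for S
  define S where "S k = (grow ^^ k) {}" for k
  have S_Suc: "S (Suc k) = grow (S k)" for k by (simp add: S_def)
  have S_mono: "S j \<subseteq> S k" if "j \<le> k" for j k
    by (rule lift_Suc_mono_le[OF _ that]) (auto simp: S_Suc grow_def)
  have S_T: "S k \<subseteq> T \<and> countable (S k)" for k
  proof (induction k)
    case (Suc k)
    then have sub: "lists (Sigma (S k) E) \<subseteq> lists (Sigma T E)" by (intro lists_mono) auto
    have "countable (Sigma (S k) E)" using Suc E(1) by (intro countable_SIGMA) auto
    moreover have "countable (D (point l))" if "l \<in> lists (Sigma (S k) E)" for l
      using that sub by (intro D(2) point_pts) blast
    ultimately have "countable (\<Union>l\<in>lists (Sigma (S k) E). D (point l))"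
      by (intro countable_UN countable_lists)
    moreover have "(\<Union>l\<in>lists (Sigma (S k) E). D (point l)) \<subseteq> T"
      using sub point_pts D(1) by blast
    ultimately show ?case using Suc by (simp add: S_Suc grow_def)
  qed (simp add: S_def)
  define T0 where "T0 = (\<Union>k. S k)"
  have T0: "T0 \<subseteq> T" "countable T0" using S_T by (auto simp: T0_def)
  \<comment> \<open>A finite list mentions finitely many indices, hence lives in a single stage of
    the increasing union.\<close>
  have stage: "\<exists>k. l \<in> lists (Sigma (S k) E)" if "l \<in> lists (Sigma T0 E)" for l
    using that
  proof (induction l rule: list.induct)
    case (Cons tp l)
    then obtain k where k: "l \<in> lists (Sigma (S k) E)" by auto
    obtain j where j: "tp \<in> Sigma (S j) E" using Cons.prems by (auto simp: T0_def)
    have sub: "Sigma (S k) E \<subseteq> Sigma (S (max j k)) E" "Sigma (S j) E \<subseteq> Sigma (S (max j k)) E"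
      using S_mono[of k "max j k"] S_mono[of j "max j k"] by auto
    have "tp # l \<in> lists (Sigma (S (max j k)) E)"
      using subsetD[OF lists_mono[OF sub(1)] k] subsetD[OF sub(2) j] by (rule lists.Cons[rotated])
    then show ?case ..
  qed auto
  have D_T0: "D (point l) \<subseteq> T0" if "l \<in> lists (Sigma T0 E)" for l
  proof -
    from stage[OF that] obtain k where "l \<in> lists (Sigma (S k) E)" ..
    then have "D (point l) \<subseteq> S (Suc k)" unfolding S_Suc grow_def by blast
    then show ?thesis unfolding T0_def by blast
  qed
  have lists_T0: "lists (Sigma T0 E) \<subseteq> lists (Sigma T E)" using T0(1) by (intro lists_mono) auto
  have f_point: "f y = f (point l)" if "l \<in> lists (Sigma T0 E)" "y \<in> pts" "\<And>t. t \<in> T0 \<Longrightarrow> y t = point l t" for l y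
    using lists_T0 that D_T0[OF that(1)] by (intro D(3) point_pts) blast+
  obtain \<delta> where \<delta>: "\<And>k. \<delta> k > 0" "\<And>x p. (\<And>k. x k \<in> pts) \<Longrightarrow> p \<in> pts \<Longrightarrow>
      (\<And>t. t \<in> T \<Longrightarrow> rapidly_converges (dim t) (A t) \<delta> (\<lambda>k. x k t) (p t)) \<Longrightarrow> (\<lambda>k. f (x k)) \<longlonglongrightarrow> f p"
    using tendsto_if_coordinates_rapidly_converge by metis
  obtain e :: "nat \<Rightarrow> 'i" where e: "T0 \<subseteq> range e"
    using subset_range_from_nat_into[OF T0(2)] by blast
  have "\<exists>L. (\<forall>k. L k \<in> lists (Sigma T0 E)) \<and>
      (\<forall>t\<in>T0. rapidly_converges (dim t) (A t) \<delta> (\<lambda>k. point (L k) t) (x t))" if x: "x \<in> pts" for x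
  proof -
    have "\<exists>\<phi> U. (\<phi>, U) \<in> A t \<and> x t \<in> U" if "t \<in> T" for t
      using atlas_covers[OF manifolds[OF that]] x that by (auto simp: PiE_iff)
    then obtain \<phi> U where chart: "\<And>t. t \<in> T \<Longrightarrow> (\<phi> t, U t) \<in> A t" "\<And>t. t \<in> T \<Longrightarrow> x t \<in> U t" by metis
    define N where "N k t = {q \<in> U t. \<forall>j<dim t. \<bar>\<phi> t q j - \<phi> t (x t) j\<bar> < \<delta> k}" for k t
    have "\<exists>d. d \<in> E t \<and> d \<in> N k t" if t: "t \<in> T" for k t
    proof -
      have "openin (M t) (N k t)"
        unfolding N_def by (rule chart_on_box_open[OF atlas_chart[OF manifolds[OF t] chart(1)[OF t]]])
      moreover have "x t \<in> N k t" using chart(2)[OF t] \<delta>(1) by (simp add: N_def)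
      ultimately show ?thesis using E(3)[OF t] dense_intersects_open[of "M t" "E t"] by blast
    qed
    note near = this
    define d where "d k t = (SOME d. d \<in> E t \<and> d \<in> N k t)" for k t
    have d: "d k t \<in> E t" "d k t \<in> N k t" if "t \<in> T" for k t
      using someI_ex[OF near[OF that]] by (simp_all add: d_def)
    \<comment> \<open>The \<open>k\<close>-th list covers the members of \<open>T0\<close> among the
      first \<open>k\<close> terms of the enumeration, with dense values within
      \<open>\<delta> k\<close>; thus \<open>e i\<close> is listed from \<open>k = Suc i\<close>
      on.\<close>
    define L where "L k = map (\<lambda>t. (t, d k t)) (filter (\<lambda>t. t \<in> T0) (map e [0..<k]))" for k
    have map_of: "map_of (map (\<lambda>t. (t, d k t)) ts) t = (if t \<in> set ts then Some (d k t) else None)" for k ts t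
      by (induction ts) auto
    have "L k \<in> lists (Sigma T0 E)" for k
      using d(1)[OF subsetD[OF T0(1)]] by (auto simp: L_def)
    moreover have "rapidly_converges (dim t) (A t) \<delta> (\<lambda>k. point (L k) t) (x t)" if t: "t \<in> T0" for t
    proof -
      have tT: "t \<in> T" using t T0(1) by blast
      obtain i where i: "t = e i" using e t by blast
      have "point (L k) t \<in> N k t" if "k \<ge> Suc i" for k
      proof -
        have "t \<in> set (filter (\<lambda>t. t \<in> T0) (map e [0..<k]))" using that i t by auto
        then have "map_of (L k) t = Some (d k t)" by (simp add: L_def map_of)
        then show ?thesis using d(2)[OF tT] tT by (simp add: point_def)
      qed
      then show ?thesis
        by (intro rapidly_converges_within_chart[OF manifolds[OF tT] chart(1,2)[OF tT]]) (simp add: N_def)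
    qed
    ultimately show ?thesis by blast
  qed
  note approx = this
  have "f x = f y" if x: "x \<in> pts" and y: "y \<in> pts" and eq: "\<forall>t\<in>T0. x t = y t" for x y
  proof -
    obtain L where L: "\<And>k. L k \<in> lists (Sigma T0 E)"
        "\<And>t. t \<in> T0 \<Longrightarrow> rapidly_converges (dim t) (A t) \<delta> (\<lambda>k. point (L k) t) (x t)"
      using approx[OF x] by blast
    have LT: "point (L k) \<in> pts" for k
      using L(1) lists_T0 by (intro point_pts) blast
    have "(\<lambda>k. f (point (L k))) \<longlonglongrightarrow> f w" if w: "w \<in> pts" "\<forall>t\<in>T0. w t = x t" for w
    proof -
      \<comment> \<open>Off \<open>T0\<close> the points \<open>point (L k)\<close> need not
        approach \<open>w\<close>. Mixing gives them the coordinates of \<open>w\<close> there, and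
        by \<open>f_point\<close> this does not change the value of \<open>f\<close>.\<close>
      have "(\<lambda>k. f (mix (point (L k)) w T0)) \<longlonglongrightarrow> f w"
      proof (rule \<delta>(2))
        fix t assume t: "t \<in> T"
        show "rapidly_converges (dim t) (A t) \<delta> (\<lambda>k. mix (point (L k)) w T0 t) (w t)"
        proof (cases "t \<in> T0")
          case True
          then show ?thesis using L(2)[OF True] w(2) t by (simp add: mix_def)
        next
          case False
          then show ?thesis using t w(1) \<delta>(1)
            by (intro rapidly_converges_eventually_const[OF manifolds[OF t]]) (auto simp: mix_def)
        qed
      qed (intro mix_in_pts LT w(1))+
      moreover have "f (mix (point (L k)) w T0) = f (point (L k))" for k
        using T0(1) by (intro f_point[OF L(1)] mix_in_pts LT w(1)) (auto simp: mix_def)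
      ultimately show ?thesis by simp
    qed
    note lim = this
    have "(\<lambda>k. f (point (L k))) \<longlonglongrightarrow> f x" "(\<lambda>k. f (point (L k))) \<longlonglongrightarrow> f y"
      using eq by (auto intro!: lim x y simp del: topspace_product_topology)
    then show ?thesis by (rule LIMSEQ_unique)
  qed
  then show ?thesis using T0 by blast
qed auto

text \<open>Sequences suffice although \<open>T\<close> may be uncountable: off \<open>T0\<close>
  the coordinates can be reset to those of \<open>p\<close> without changing \<open>f\<close>, and
  on \<open>T0\<close> they are controlled along an enumeration.\<close>

lemma continuous_if_countably_many_coordinates:
  assumes T0: "T0 \<subseteq> T" "countable T0"
    and det: "\<And>x y. x \<in> pts \<Longrightarrow> y \<in> pts \<Longrightarrow> (\<And>t. t \<in> T0 \<Longrightarrow> x t = y t) \<Longrightarrow> f x = f y"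
  shows "continuous_map (product_topology M T) euclideanreal f"
proof -
  obtain \<delta> where \<delta>: "\<And>k. \<delta> k > 0" "\<And>x p. (\<And>k. x k \<in> pts) \<Longrightarrow> p \<in> pts \<Longrightarrow>
      (\<And>t. t \<in> T \<Longrightarrow> rapidly_converges (dim t) (A t) \<delta> (\<lambda>k. x k t) (p t)) \<Longrightarrow> (\<lambda>k. f (x k)) \<longlonglongrightarrow> f p"
    using tendsto_if_coordinates_rapidly_converge by metis
  obtain e :: "nat \<Rightarrow> 'i" where e: "T0 \<subseteq> range e"
    using subset_range_from_nat_into[OF T0(2)] by blast
  have "\<exists>W. openin (product_topology M T) W \<and> p \<in> W \<and> W \<subseteq> {x \<in> pts. f x \<in> V}"
    if V: "open V" and p: "p \<in> pts" "f p \<in> V" for V p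
  proof (rule ccontr)
    assume neg: "\<not> ?thesis"
    have "\<exists>\<phi> U. (\<phi>, U) \<in> A t \<and> p t \<in> U" if "t \<in> T" for t
      using atlas_covers[OF manifolds[OF that]] p(1) that by (auto simp: PiE_iff)
    then obtain \<phi> U where chart: "\<And>t. t \<in> T \<Longrightarrow> (\<phi> t, U t) \<in> A t" "\<And>t. t \<in> T \<Longrightarrow> p t \<in> U t" by metis
    define N where "N k t = {q \<in> U t. \<forall>j<dim t. \<bar>\<phi> t q j - \<phi> t (p t) j\<bar> < \<delta> k}" for k t
    have N: "openin (M t) (N k t)" "p t \<in> N k t" if t: "t \<in> T" for k t
    proof -
      show "openin (M t) (N k t)"
        unfolding N_def by (rule chart_on_box_open[OF atlas_chart[OF manifolds[OF t] chart(1)[OF t]]])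
      show "p t \<in> N k t" using chart(2)[OF t] \<delta>(1) by (simp add: N_def)
    qed
    \<comment> \<open>Finitely many coordinates are constrained, so the box is open, yet each
      coordinate in \<open>T0\<close> is constrained at the rate \<open>\<delta>\<close> from some
      \<open>k\<close> on.\<close>
    define W where "W k = (\<Pi>\<^sub>E t\<in>T. if t \<in> e ` {..<k} then N k t else topspace (M t))" for k
    have "\<exists>x. x \<in> W k \<and> x \<in> pts \<and> f x \<notin> V" for k
    proof -
      have "finite {t \<in> T. (if t \<in> e ` {..<k} then N k t else topspace (M t)) \<noteq> topspace (M t)}"
        by (rule finite_subset[of _ "e ` {..<k}"]) auto
      then have op: "openin (product_topology M T) (W k)"
        unfolding W_def openin_PiE_gen using N(1) by auto
      moreover have "p \<in> W k" using p(1) N(2) by (auto simp: W_def PiE_iff)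
      ultimately have "\<not> W k \<subseteq> {x \<in> pts. f x \<in> V}" using neg by blast
      then show ?thesis using openin_subset[OF op] by blast
    qed
    then obtain x where x: "\<And>k. x k \<in> W k" "\<And>k. x k \<in> pts" "\<And>k. f (x k) \<notin> V" by metis
    have "(\<lambda>k. f (mix (x k) p T0)) \<longlonglongrightarrow> f p"
    proof (rule \<delta>(2))
      fix t assume t: "t \<in> T"
      show "rapidly_converges (dim t) (A t) \<delta> (\<lambda>k. mix (x k) p T0 t) (p t)"
      proof (cases "t \<in> T0")
        case True
        then obtain i where i: "t = e i" using e by blast
        have "x k t \<in> N k t" if "k \<ge> Suc i" for k
        proof -
          have "t \<in> e ` {..<k}" using that i by auto
          then show ?thesis using x(1)[of k] t by (auto simp: W_def PiE_iff)
        qed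
        then show ?thesis using True t
          by (intro rapidly_converges_within_chart[OF manifolds[OF t] chart(1,2)[OF t]]) (simp add: N_def mix_def)
      next
        case False
        then show ?thesis using t p(1) \<delta>(1)
          by (intro rapidly_converges_eventually_const[OF manifolds[OF t]]) (auto simp: mix_def)
      qed
    qed (intro mix_in_pts x p(1))+
    moreover have "f (mix (x k) p T0) = f (x k)" for k
      using T0(1) by (intro det mix_in_pts x p(1)) (auto simp: mix_def)
    ultimately have "(\<lambda>k. f (x k)) \<longlonglongrightarrow> f p" by simp
    then have "\<forall>\<^sub>F k in sequentially. f (x k) \<in> V" using V p(2) by (rule topological_tendstoD)
    then show False using x(3) by simp
  qed
  then have "openin (product_topology M T) {x \<in> pts. f x \<in> V}" if "open V" for V
    using that openin_subopen[of "product_topology M T" "{x \<in> pts. f x \<in> V}"] by blast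
  then show ?thesis by (simp add: continuous_map_def)
qed

text \<open>The coordinates outside \<open>T0\<close> are frozen at those of \<open>z\<close> and
  give constant curves, so every curve in the small product extends to the full one. This supplies
  the function through which \<open>f\<close> factors.\<close>

lemma prod_smooth_fix_coordinates:
  assumes "T0 \<subseteq> T" "z \<in> pts"
  shows "prod_smooth M A T0 (\<lambda>u. f (mix u z T0))"
  unfolding prod_smooth_def
proof (intro allI impI)
  fix c assume c: "prod_curve M A T0 c"
  have "mix (c s) z T0 \<in> pts" for s
    using c assms by (auto simp: prod_curve_def mix_def PiE_iff)
  moreover have "smooth_curve (M t) (A t) (\<lambda>s. mix (c s) z T0 t)" if "t \<in> T" for t
    using c assms that
    by (cases "t \<in> T0") (auto simp: prod_curve_def mix_def PiE_iff intro!: smooth_curve_const)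
  ultimately have "prod_curve M A T (\<lambda>s. mix (c s) z T0)" by (simp add: prod_curve_def)
  then have "smooth_real UNIV (f \<circ> (\<lambda>s. mix (c s) z T0))" using smooth by (simp add: prod_smooth_def)
  then show "smooth_real UNIV ((\<lambda>u. f (mix u z T0)) \<circ> c)" by (simp add: comp_def)
qed

lemma smooth_function_on_product_countably_cylindrical:
  assumes card: "T \<lesssim> (UNIV :: real set)"
  shows "continuous_map (product_topology M T) euclideanreal f
         \<and> (\<exists>T0. T0 \<subseteq> T \<and> countable T0
              \<and> (\<exists>g. prod_smooth M A T0 g \<and> (\<forall>x\<in>pts. f x = g (restrict x T0))))"
proof (cases "pts = {}")
  case True
  \<comment> \<open>An empty product has an empty factor; over that single index there is no curve,
    so \<open>f\<close> itself is vacuously smooth.\<close>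
  then obtain t where t: "t \<in> T" "topspace (M t) = {}" by (auto simp: PiE_eq_empty_iff)
  then have "prod_smooth M A {t} f" by (auto simp: prod_smooth_def prod_curve_def PiE_iff)
  then have "\<exists>T0. T0 \<subseteq> T \<and> countable T0
      \<and> (\<exists>g. prod_smooth M A T0 g \<and> (\<forall>x\<in>pts. f x = g (restrict x T0)))"
    using t True by (intro exI[of _ "{t}"]) auto
  moreover have "continuous_map (product_topology M T) euclideanreal f"
    unfolding continuous_map_def True by auto
  ultimately show ?thesis by blast
next
  case False
  then obtain z where z: "z \<in> pts" by blast
  obtain T0 where T0: "T0 \<subseteq> T" "countable T0"
    and "\<forall>x\<in>pts. \<forall>y\<in>pts. (\<forall>t\<in>T0. x t = y t) \<longrightarrow> f x = f y"
    using countably_many_coordinates_determine[OF card] by (elim exE conjE)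
  then have det: "f x = f y" if "x \<in> pts" "y \<in> pts" "\<And>t. t \<in> T0 \<Longrightarrow> x t = y t" for x y
    using that by blast
  have "f x = f (mix (restrict x T0) z T0)" if "x \<in> pts" for x
  proof -
    have "mix (restrict x T0) z T0 = mix x z T0" by (auto simp: mix_def)
    moreover have "f x = f (mix x z T0)"
      using T0(1) by (intro det mix_in_pts that z) (auto simp: mix_def)
    ultimately show ?thesis by simp
  qed
  then show ?thesis
    using continuous_if_countably_many_coordinates[OF T0 det] prod_smooth_fix_coordinates[OF T0(1) z] T0
    by blast
qed

end

theorem theorem11:
  fixes M :: "'i \<Rightarrow> 'a topology"
    and A :: "'i \<Rightarrow> (('a \<Rightarrow> nat \<Rightarrow> real) \<times> 'a set) set"
    and dim :: "'i \<Rightarrow> nat"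
    and T :: "'i set"
    and f :: "('i \<Rightarrow> 'a) \<Rightarrow> real"
  assumes "\<forall>t\<in>T. smooth_manifold (M t) (dim t) (A t)"
    and "\<forall>t\<in>T. connected_space (M t)"
    and "T \<lesssim> (UNIV :: real set)"
    and "prod_smooth M A T f"
  shows "continuous_map (product_topology M T) euclideanreal f
         \<and> (\<exists>T0. T0 \<subseteq> T \<and> countable T0
              \<and> (\<exists>g. prod_smooth M A T0 g
                     \<and> (\<forall>x\<in>topspace (product_topology M T). f x = g (restrict x T0))))"
  using smooth_function_on_product_countably_cylindrical[of T M dim A f] assms by blast

end
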